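(* Let $k$ be a field of characteristic $p>2$, let $R=W_2(k)$, and let $A$ be a finitely generated flat $R$-algebra with mod $p$ reduction $A_0$. Let $\alpha\colon A_0\to\Omega_A^{1,\mathrm{tot}}$ be the $A_0$-module homomorphism $\alpha(x)=x\,d^{\mathrm{tot}}p$. Then left-inverses $h\colon\Omega_A^{1,\mathrm{tot}}\to A_0$ of $\alpha$ are in bijective correspondence with lifts of Frobenius on $A$, where the correspondence is given by $$h\mapsto\left[\phi_h\colon x\mapsto x^p+p\,h(d^{\mathrm{tot}}x)\right].$$
   Context: All rings are commutative with $1$. $W_2(k)$ is the ring of $p$-typical Witt vectors of length $2$, and $\phi\colon R\to R$ is its Frobenius homomorphism. For $r\in R$, write $r$ also for $r\cdot 1\in A$. Set $C_p(X,Y)=\frac{X^p+Y^p-(X+Y)^p}{p}\in\mathbb{Z}[X,Y]$. For $r\in R$, $(\phi(r)-r^p)/p$ denotes the element $x\in k$ such that $p\tilde x=\phi(r)-r^p$ for any lift $\tilde x\in R$ of $x$. The mod $p$ reduction $A_0$ of $A$ is treated as a $k$-algebra; for $y\in A_0$, $py\in A$ means $p\tilde y$ for any lift $\tilde y\in A$ of $y$. The module of total $p$-differentials $\Omega_A^{1,\mathrm{tot}}$ is the $A_0$-module generated by symbols $d^{\mathrm{tot}}x$ for $x\in A$ subject to the relations (1) $d^{\mathrm{tot}}(a+b)=d^{\mathrm{tot}}a+d^{\mathrm{tot}}b+C_p(a,b)\,d^{\mathrm{tot}}p$ for $a,b\in A$; (2) $d^{\mathrm{tot}}(ab)=b^p\,d^{\mathrm{tot}}a+a^p\,d^{\mathrm{tot}}b$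 for $a,b\in A$; (3) $d^{\mathrm{tot}}r=\frac{\phi(r)-r^p}{p}\,d^{\mathrm{tot}}p$ for $r\in R$, where $A$ acts through the reduction $A\to A_0$. A left-inverse of $\alpha$ is an $A_0$-module homomorphism $h\colon\Omega_A^{1,\mathrm{tot}}\to A_0$ with $h(d^{\mathrm{tot}}p)=1$. A lift of Frobenius on $A$ is a ring homomorphism $\phi_A\colon A\to A$ that restricts to the Frobenius $\phi$ on $R$ (i.e. $\phi_A(r\cdot 1)=\phi(r)\cdot 1$) and satisfies $\pi_0(\phi_A(x))=\pi_0(x)^p$ for all $x\in A$, where $\pi_0\colon A\to A_0$ is the reduction map.
   Formalization: The formal theorem assumes that the scalar action of R on A/pA makes A_0 a k-algebra; this is automatic for perfect k and fails for imperfect k unless A = 0, where relation (3) has no meaning. *)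

theory Defs
  imports "HOL-Algebra.Module" "HOL-Algebra.QuotRing" "HOL-Algebra.Generated_Rings"
begin

section \<open>Modules: homomorphisms, quotients, free modules, tensor products, flatness\<close>

text \<open>Homomorphisms are taken extensional, so that they can be counted as functions on the carrier.\<close>

definition module_homs ::
  "('r, 'e) ring_scheme \<Rightarrow> ('r, 'm, 'f) module_scheme \<Rightarrow> ('r, 'n, 'g) module_scheme \<Rightarrow> ('m \<Rightarrow> 'n) set"
  where "module_homs R M N =
    {h \<in> carrier M \<rightarrow>\<^sub>E carrier N.
       (\<forall>x\<in>carrier M. \<forall>y\<in>carrier M. h (x \<oplus>\<^bsub>M\<^esub> y) = h x \<oplus>\<^bsub>N\<^esub> h y) \<and>
       (\<forall>r\<in>carrier R. \<forall>x\<in>carrier M. h (r \<odot>\<^bsub>M\<^esub> x) = r \<odot>\<^bsub>N\<^esub> h x)}"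

definition submodule_gen ::
  "('r, 'e) ring_scheme \<Rightarrow> ('r, 'm, 'f) module_scheme \<Rightarrow> 'm set \<Rightarrow> 'm set"
  where "submodule_gen R M G = \<Inter>{N. submodule N R M \<and> G \<subseteq> N}"

text \<open>The library's record type for modules extends that of rings; the fields \<open>mult\<close> and \<open>one\<close>
  of a record that is used only as a module carry no meaning.\<close>

definition quot_module :: "('r, 'm, 'f) module_scheme \<Rightarrow> 'm set \<Rightarrow> ('r, 'm set) module"
  where "quot_module M N =
    \<lparr>carrier = a_rcosets\<^bsub>M\<^esub> N, mult = undefined, one = undefined,
     zero = N, add = set_add M,
     smult = (\<lambda>r S. \<Union>x\<in>S. N +>\<^bsub>M\<^esub> (r \<odot>\<^bsub>M\<^esub> x))\<rparr>"

definition free_module :: "('r, 'e) ring_scheme \<Rightarrow> 'x set \<Rightarrow> ('r, 'x \<Rightarrow> 'r) module"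
  where "free_module R S =
    \<lparr>carrier = {f. (\<forall>x\<in>S. f x \<in> carrier R) \<and> (\<forall>x. x \<notin> S \<longrightarrow> f x = \<zero>\<^bsub>R\<^esub>) \<and>
                  finite {x. f x \<noteq> \<zero>\<^bsub>R\<^esub>}},
     mult = undefined, one = undefined,
     zero = (\<lambda>x. \<zero>\<^bsub>R\<^esub>), add = (\<lambda>f g x. f x \<oplus>\<^bsub>R\<^esub> g x),
     smult = (\<lambda>r f x. r \<otimes>\<^bsub>R\<^esub> f x)\<rparr>"

definition basis_elt :: "('r, 'e) ring_scheme \<Rightarrow> 'x \<Rightarrow> 'x \<Rightarrow> 'r"
  where "basis_elt R x = (\<lambda>y. if y = x then \<one>\<^bsub>R\<^esub> else \<zero>\<^bsub>R\<^esub>)"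

definition self_module :: "('r, 'e) ring_scheme \<Rightarrow> ('r, 'r) module"
  where "self_module R =
    \<lparr>carrier = carrier R, mult = mult R, one = one R, zero = zero R, add = add R, smult = mult R\<rparr>"

definition tensor_relations ::
  "('r, 'e) ring_scheme \<Rightarrow> ('r, 'm, 'f) module_scheme \<Rightarrow> ('r, 'n, 'g) module_scheme \<Rightarrow> ('m \<times> 'n \<Rightarrow> 'r) set"
  where "tensor_relations R M N =
    (let F = free_module R (carrier M \<times> carrier N); e = basis_elt R in
     {e (x \<oplus>\<^bsub>M\<^esub> x', y) \<ominus>\<^bsub>F\<^esub> (e (x, y) \<oplus>\<^bsub>F\<^esub> e (x', y)) | x x' y.
        x \<in> carrier M \<and> x' \<in> carrier M \<and> y \<in> carrier N} \<union>
     {e (x, y \<oplus>\<^bsub>N\<^esub> y') \<ominus>\<^bsub>F\<^esub> (e (x, y) \<oplus>\<^bsub>F\<^esub> e (x, y')) | x y y'.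
        x \<in> carrier M \<and> y \<in> carrier N \<and> y' \<in> carrier N} \<union>
     {e (r \<odot>\<^bsub>M\<^esub> x, y) \<ominus>\<^bsub>F\<^esub> r \<odot>\<^bsub>F\<^esub> e (x, y) | r x y.
        r \<in> carrier R \<and> x \<in> carrier M \<and> y \<in> carrier N} \<union>
     {e (x, r \<odot>\<^bsub>N\<^esub> y) \<ominus>\<^bsub>F\<^esub> r \<odot>\<^bsub>F\<^esub> e (x, y) | r x y.
        r \<in> carrier R \<and> x \<in> carrier M \<and> y \<in> carrier N})"

definition tensor_kernel ::
  "('r, 'e) ring_scheme \<Rightarrow> ('r, 'm, 'f) module_scheme \<Rightarrow> ('r, 'n, 'g) module_scheme \<Rightarrow> ('m \<times> 'n \<Rightarrow> 'r) set"
  where "tensor_kernel R M N =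
    submodule_gen R (free_module R (carrier M \<times> carrier N)) (tensor_relations R M N)"

definition tensor_module ::
  "('r, 'e) ring_scheme \<Rightarrow> ('r, 'm, 'f) module_scheme \<Rightarrow> ('r, 'n, 'g) module_scheme \<Rightarrow>
     ('r, ('m \<times> 'n \<Rightarrow> 'r) set) module"
  where "tensor_module R M N =
    quot_module (free_module R (carrier M \<times> carrier N)) (tensor_kernel R M N)"

definition pure_tensor ::
  "('r, 'e) ring_scheme \<Rightarrow> ('r, 'm, 'f) module_scheme \<Rightarrow> ('r, 'n, 'g) module_scheme \<Rightarrow>
     'm \<Rightarrow> 'n \<Rightarrow> ('m \<times> 'n \<Rightarrow> 'r) set"
  where "pure_tensor R M N x y =
    tensor_kernel R M N +>\<^bsub>free_module R (carrier M \<times> carrier N)\<^esub> basis_elt R (x, y)"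

text \<open>Flatness: tensoring with \<open>M\<close> preserves injectivity of module homomorphisms \<open>f : N \<rightarrow> N'\<close>,
  where \<open>g\<close> is the (unique) induced map \<open>id \<otimes> f\<close>.  HOL cannot quantify over types inside a
  formula, so \<open>N\<close> and \<open>N'\<close> range over the modules whose elements have the element type of \<open>R\<close>.
  These include \<open>R\<close> and all of its ideals, so by the ideal criterion nothing is lost.\<close>

definition flat_module :: "('r, 'e) ring_scheme \<Rightarrow> ('r, 'm, 'f) module_scheme \<Rightarrow> bool"
  where "flat_module R M \<longleftrightarrow> module R M \<and>
    (\<forall>(N :: ('r, 'r) module) (N' :: ('r, 'r) module) f.
       module R N \<and> module R N' \<and> f \<in> module_homs R N N' \<and> inj_on f (carrier N) \<longrightarrow>
       (\<exists>g \<in> module_homs R (tensor_module R M N) (tensor_module R M N').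
          (\<forall>x\<in>carrier M. \<forall>y\<in>carrier N. g (pure_tensor R M N x y) = pure_tensor R M N' x (f y)) \<and>
          inj_on g (carrier (tensor_module R M N))))"

definition finitely_generated_algebra ::
  "('r, 'e) ring_scheme \<Rightarrow> ('r, 'a, 'f) module_scheme \<Rightarrow> bool"
  where "finitely_generated_algebra R A \<longleftrightarrow> algebra R A \<and>
    (\<exists>S. finite S \<and> S \<subseteq> carrier A \<and>
       generate_ring A ((\<lambda>r. r \<odot>\<^bsub>A\<^esub> \<one>\<^bsub>A\<^esub>) ` carrier R \<union> S) = carrier A)"


section \<open>Witt vectors of length 2\<close>

definition ring_char :: "('a, 'e) ring_scheme \<Rightarrow> nat"
  where "ring_char R =
    (if \<exists>n::nat. 0 < n \<and> [n] \<cdot>\<^bsub>R\<^esub> \<one>\<^bsub>R\<^esub> = \<zero>\<^bsub>R\<^esub>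
     then LEAST n::nat. 0 < n \<and> [n] \<cdot>\<^bsub>R\<^esub> \<one>\<^bsub>R\<^esub> = \<zero>\<^bsub>R\<^esub> else 0)"

text \<open>The value at \<open>(a, b)\<close> of the integral polynomial \<open>(X^p + Y^p - (X + Y)^p) / p\<close>, \<open>p\<close> prime,
  expanded by the binomial theorem.\<close>

definition Cp :: "nat \<Rightarrow> ('a, 'e) ring_scheme \<Rightarrow> 'a \<Rightarrow> 'a \<Rightarrow> 'a"
  where "Cp p R a b =
    \<ominus>\<^bsub>R\<^esub> (\<Oplus>\<^bsub>R\<^esub>i\<in>{1..<p}. [((p choose i) div p)] \<cdot>\<^bsub>R\<^esub> (a [^]\<^bsub>R\<^esub> i \<otimes>\<^bsub>R\<^esub> b [^]\<^bsub>R\<^esub> (p - i)))"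

text \<open>In Witt coordinates, with ghost components \<open>x0\<close> and \<open>x0^p + p x1\<close>.\<close>

definition W2 :: "nat \<Rightarrow> ('k, 'e) ring_scheme \<Rightarrow> ('k \<times> 'k) ring"
  where "W2 p k =
    \<lparr>carrier = carrier k \<times> carrier k,
     mult = (\<lambda>(x0, x1) (y0, y1).
       (x0 \<otimes>\<^bsub>k\<^esub> y0,
        x0 [^]\<^bsub>k\<^esub> p \<otimes>\<^bsub>k\<^esub> y1 \<oplus>\<^bsub>k\<^esub> y0 [^]\<^bsub>k\<^esub> p \<otimes>\<^bsub>k\<^esub> x1 \<oplus>\<^bsub>k\<^esub> [p] \<cdot>\<^bsub>k\<^esub> (x1 \<otimes>\<^bsub>k\<^esub> y1))),
     one = (\<one>\<^bsub>k\<^esub>, \<zero>\<^bsub>k\<^esub>),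
     zero = (\<zero>\<^bsub>k\<^esub>, \<zero>\<^bsub>k\<^esub>),
     add = (\<lambda>(x0, x1) (y0, y1). (x0 \<oplus>\<^bsub>k\<^esub> y0, x1 \<oplus>\<^bsub>k\<^esub> y1 \<oplus>\<^bsub>k\<^esub> Cp p k x0 y0))\<rparr>"

text \<open>For \<open>k\<close> of characteristic \<open>p\<close> the Witt vector Frobenius is \<open>W_2\<close> of the \<open>p\<close>-power map of \<open>k\<close>.
  The residue map from \<open>W_2(k)\<close> onto \<open>k\<close> is \<open>fst\<close>.\<close>

definition W2_frob :: "nat \<Rightarrow> ('k, 'e) ring_scheme \<Rightarrow> 'k \<times> 'k \<Rightarrow> 'k \<times> 'k"
  where "W2_frob p k = (\<lambda>(x0, x1). (x0 [^]\<^bsub>k\<^esub> p, x1 [^]\<^bsub>k\<^esub> p))"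

text \<open>The element \<open>(\<phi>(r) - r^p) / p\<close> of \<open>k\<close>.\<close>

definition frob_quotient :: "nat \<Rightarrow> ('k, 'e) ring_scheme \<Rightarrow> 'k \<times> 'k \<Rightarrow> 'k"
  where "frob_quotient p k r =
    (THE x. x \<in> carrier k \<and>
       (\<forall>x'\<in>carrier (W2 p k). fst x' = x \<longrightarrow>
          [p] \<cdot>\<^bsub>W2 p k\<^esub> x' = W2_frob p k r \<ominus>\<^bsub>W2 p k\<^esub> r [^]\<^bsub>W2 p k\<^esub> p))"


section \<open>The reduction modulo \<open>p\<close>\<close>

definition p_elt :: "nat \<Rightarrow> ('a, 'e) ring_scheme \<Rightarrow> 'a"
  where "p_elt p A = [p] \<cdot>\<^bsub>A\<^esub> \<one>\<^bsub>A\<^esub>"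

definition red :: "nat \<Rightarrow> ('a, 'e) ring_scheme \<Rightarrow> 'a \<Rightarrow> 'a set"
  where "red p A x = (PIdl\<^bsub>A\<^esub> (p_elt p A)) +>\<^bsub>A\<^esub> x"

text \<open>The ring \<open>A / pA\<close> with the scalar multiplication by \<open>k\<close> induced from that of \<open>A\<close> by \<open>W_2(k)\<close>:
  \<open>c\<close> times the class of \<open>x\<close> is the class of \<open>r x\<close> for any lift \<open>r\<close> of \<open>c\<close>.  The union below is a
  single coset precisely when this class does not depend on the choice of \<open>r\<close>.  That is automatic
  if \<open>k\<close> is perfect; in general it is part of requiring that \<open>reduction p k A\<close> be a \<open>k\<close>-algebra.\<close>

definition reduction ::
  "nat \<Rightarrow> ('k, 'e) ring_scheme \<Rightarrow> ('k \<times> 'k, 'a, 'f) module_scheme \<Rightarrow> ('k, 'a set) module"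
  where "reduction p k A =
    (let A0 = A Quot (PIdl\<^bsub>A\<^esub> (p_elt p A)) in
     \<lparr>carrier = carrier A0, mult = mult A0, one = one A0, zero = zero A0, add = add A0,
      smult = (\<lambda>c S. \<Union>r\<in>{r \<in> carrier (W2 p k). fst r = c}. \<Union>x\<in>S. red p A (r \<odot>\<^bsub>A\<^esub> x))\<rparr>)"

definition times_p :: "nat \<Rightarrow> ('a, 'e) ring_scheme \<Rightarrow> 'a set \<Rightarrow> 'a"
  where "times_p p A y = (THE a. \<forall>y'\<in>carrier A. red p A y' = y \<longrightarrow> [p] \<cdot>\<^bsub>A\<^esub> y' = a)"


section \<open>Total \<open>p\<close>-differentials\<close>

definition tot_relations ::
  "nat \<Rightarrow> ('k, 'e) ring_scheme \<Rightarrow> ('k \<times> 'k, 'a, 'f) module_scheme \<Rightarrow> ('a \<Rightarrow> 'a set) set"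
  where "tot_relations p k A =
    (let A0 = reduction p k A; F = free_module A0 (carrier A); d = basis_elt A0 in
     {d (a \<oplus>\<^bsub>A\<^esub> b) \<ominus>\<^bsub>F\<^esub> (d a \<oplus>\<^bsub>F\<^esub> d b \<oplus>\<^bsub>F\<^esub> red p A (Cp p A a b) \<odot>\<^bsub>F\<^esub> d (p_elt p A)) | a b.
        a \<in> carrier A \<and> b \<in> carrier A} \<union>
     {d (a \<otimes>\<^bsub>A\<^esub> b) \<ominus>\<^bsub>F\<^esub>
        (red p A (b [^]\<^bsub>A\<^esub> p) \<odot>\<^bsub>F\<^esub> d a \<oplus>\<^bsub>F\<^esub> red p A (a [^]\<^bsub>A\<^esub> p) \<odot>\<^bsub>F\<^esub> d b) | a b.
        a \<in> carrier A \<and> b \<in> carrier A} \<union>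
     {d (r \<odot>\<^bsub>A\<^esub> \<one>\<^bsub>A\<^esub>) \<ominus>\<^bsub>F\<^esub>
        (frob_quotient p k r \<odot>\<^bsub>A0\<^esub> \<one>\<^bsub>A0\<^esub>) \<odot>\<^bsub>F\<^esub> d (p_elt p A) | r.
        r \<in> carrier (W2 p k)})"

definition tot_kernel ::
  "nat \<Rightarrow> ('k, 'e) ring_scheme \<Rightarrow> ('k \<times> 'k, 'a, 'f) module_scheme \<Rightarrow> ('a \<Rightarrow> 'a set) set"
  where "tot_kernel p k A =
    submodule_gen (reduction p k A) (free_module (reduction p k A) (carrier A)) (tot_relations p k A)"

definition Omega_tot ::
  "nat \<Rightarrow> ('k, 'e) ring_scheme \<Rightarrow> ('k \<times> 'k, 'a, 'f) module_scheme \<Rightarrow>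
     ('a set, ('a \<Rightarrow> 'a set) set) module"
  where "Omega_tot p k A =
    quot_module (free_module (reduction p k A) (carrier A)) (tot_kernel p k A)"

definition d_tot ::
  "nat \<Rightarrow> ('k, 'e) ring_scheme \<Rightarrow> ('k \<times> 'k, 'a, 'f) module_scheme \<Rightarrow> 'a \<Rightarrow> ('a \<Rightarrow> 'a set) set"
  where "d_tot p k A x =
    tot_kernel p k A +>\<^bsub>free_module (reduction p k A) (carrier A)\<^esub> basis_elt (reduction p k A) x"

definition alpha_tot ::
  "nat \<Rightarrow> ('k, 'e) ring_scheme \<Rightarrow> ('k \<times> 'k, 'a, 'f) module_scheme \<Rightarrow> 'a set \<Rightarrow> ('a \<Rightarrow> 'a set) set"
  where "alpha_tot p k A x = x \<odot>\<^bsub>Omega_tot p k A\<^esub> d_tot p k A (p_elt p A)"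

text \<open>Left-inverses of \<open>\<alpha>\<close>; the lemma \<open>alpha_left_inverse_iff\<close> below justifies the name.\<close>

definition alpha_left_inverses ::
  "nat \<Rightarrow> ('k, 'e) ring_scheme \<Rightarrow> ('k \<times> 'k, 'a, 'f) module_scheme \<Rightarrow>
     (('a \<Rightarrow> 'a set) set \<Rightarrow> 'a set) set"
  where "alpha_left_inverses p k A =
    {h \<in> module_homs (reduction p k A) (Omega_tot p k A) (self_module (reduction p k A)).
       h (d_tot p k A (p_elt p A)) = \<one>\<^bsub>reduction p k A\<^esub>}"

definition frobenius_lifts ::
  "nat \<Rightarrow> ('k, 'e) ring_scheme \<Rightarrow> ('k \<times> 'k, 'a, 'f) module_scheme \<Rightarrow> ('a \<Rightarrow> 'a) set"
  where "frobenius_lifts p k A =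
    {\<phi> \<in> ring_hom A A \<inter> extensional (carrier A).
       (\<forall>r\<in>carrier (W2 p k). \<phi> (r \<odot>\<^bsub>A\<^esub> \<one>\<^bsub>A\<^esub>) = W2_frob p k r \<odot>\<^bsub>A\<^esub> \<one>\<^bsub>A\<^esub>) \<and>
       (\<forall>x\<in>carrier A. red p A (\<phi> x) = red p A x [^]\<^bsub>reduction p k A\<^esub> p)}"

definition lift_of_left_inverse ::
  "nat \<Rightarrow> ('k, 'e) ring_scheme \<Rightarrow> ('k \<times> 'k, 'a, 'f) module_scheme \<Rightarrow>
     (('a \<Rightarrow> 'a set) set \<Rightarrow> 'a set) \<Rightarrow> 'a \<Rightarrow> 'a"
  where "lift_of_left_inverse p k A h =
    (\<lambda>x\<in>carrier A. x [^]\<^bsub>A\<^esub> p \<oplus>\<^bsub>A\<^esub> times_p p A (h (d_tot p k A x)))"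

lemma d_tot_closed:
  assumes "cring (reduction p k A)" and "x \<in> carrier A"
  shows "d_tot p k A x \<in> carrier (Omega_tot p k A)"
proof -
  interpret cring "reduction p k A" by fact
  have "finite {y. basis_elt (reduction p k A) x y \<noteq> \<zero>\<^bsub>reduction p k A\<^esub>}"
    by (rule finite_subset[of _ "{x}"]) (auto simp: basis_elt_def)
  then have "basis_elt (reduction p k A) x \<in> carrier (free_module (reduction p k A) (carrier A))"
    using assms(2) by (auto simp: free_module_def basis_elt_def)
  then show ?thesis
    unfolding d_tot_def Omega_tot_def quot_module_def
    by (auto simp: A_RCOSETS_def a_r_coset_def RCOSETS_def)
qed

lemma alpha_left_inverse_iff:
  assumes A: "cring A" and A0: "cring (reduction p k A)"
    and h: "h \<in> module_homs (reduction p k A) (Omega_tot p k A) (self_module (reduction p k A))"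
  shows "h \<in> alpha_left_inverses p k A \<longleftrightarrow>
    (\<forall>x\<in>carrier (reduction p k A). h (alpha_tot p k A x) = x)"
proof -
  interpret A: cring A by fact
  interpret A0: cring "reduction p k A" by fact
  let ?d = "d_tot p k A (p_elt p A)"
  have d: "?d \<in> carrier (Omega_tot p k A)"
    by (rule d_tot_closed[OF A0]) (simp add: p_elt_def)
  have hd: "h ?d \<in> carrier (reduction p k A)"
    using h d by (auto simp: module_homs_def self_module_def)
  have *: "h (alpha_tot p k A x) = x \<otimes>\<^bsub>reduction p k A\<^esub> h ?d"
    if "x \<in> carrier (reduction p k A)" for x
    using h d that by (auto simp: module_homs_def self_module_def alpha_tot_def)
  have "h ?d = \<one>\<^bsub>reduction p k A\<^esub> \<longleftrightarrow>
      (\<forall>x\<in>carrier (reduction p k A). h (alpha_tot p k A x) = x)"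
    using * A0.one_closed A0.l_one[OF hd] A0.r_one by metis
  then show ?thesis
    using h by (simp add: alpha_left_inverses_def)
qed

end

(* A homomorphism from Omega to A_0 with h(dp) = 1 is the same thing as a map delta: A -> A_0
   satisfying the three relations with 1 in place of dp.  Multiplication by p induces an A-linear map
   A_0 -> A whose image has square zero; flatness makes it injective, and since p C_p(a,b) =
   a^p + b^p - (a+b)^p, the relations for delta say exactly that x |-> x^p + p delta(x) is additive,
   multiplicative and equal to phi on R.  Conversely, a lift of Frobenius differs from the p-th power
   by p delta for a unique delta, and delta(p) = 1 because phi(p) = p and p^p = 0.

   For injectivity, multiplication by p on R = W_2(k) factors through an injective R-linear map k -> R,
   (x, 0) |-> (0, x^p), so if p a = 0 then a (x) 1 = 0 in the tensor product of A and k over R.  The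
   scalar multiplication of the k-algebra A_0 maps a (x) 1 to the class of a, which therefore
   vanishes. *)

theory Submission
  imports Defs "HOL-Computational_Algebra.Primes"
begin

section \<open>Modules\<close>

text \<open>The field k need not be perfect, and this shapes the proof. In Witt coordinates p is (0,
  1) and p (x0, x1) = (0, x0^p), so the kernel of multiplication by p on R is the whole ideal of
  pairs (0, y), while its image contains only those with y a p-th power. Thus R/pR can be larger
  than k, and flatness alone makes the p-torsion of A the ideal spanned by the scalars (0, y), which
  need not be pA. The gap is closed by the assumption that A_0 is a k-algebra: a scalar (0, y) then
  acts on A_0 as 0. The same coordinates explain the p-th power in the map k -> R: it makes the map
  linear for the action of R on k through the residue map, and it keeps the map injective because k
  is reduced. They also show that (phi(r) - r^p)/p is just the second coordinate of r.\<close>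

lemma module_homs_closed:
  "h \<in> module_homs R M N \<Longrightarrow> x \<in> carrier M \<Longrightarrow> h x \<in> carrier N"
  by (auto simp: module_homs_def)

lemma module_homs_add:
  "h \<in> module_homs R M N \<Longrightarrow> x \<in> carrier M \<Longrightarrow> y \<in> carrier M \<Longrightarrow>
    h (x \<oplus>\<^bsub>M\<^esub> y) = h x \<oplus>\<^bsub>N\<^esub> h y"
  by (auto simp: module_homs_def)

lemma module_homs_smult:
  "h \<in> module_homs R M N \<Longrightarrow> r \<in> carrier R \<Longrightarrow> x \<in> carrier M \<Longrightarrow>
    h (r \<odot>\<^bsub>M\<^esub> x) = r \<odot>\<^bsub>N\<^esub> h x"
  by (auto simp: module_homs_def)

lemma module_homs_minus:
  assumes "abelian_group M" and "abelian_group N" and h: "h \<in> module_homs R M N"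
    and x: "x \<in> carrier M" and y: "y \<in> carrier M"
  shows "h (x \<ominus>\<^bsub>M\<^esub> y) = h x \<ominus>\<^bsub>N\<^esub> h y"
proof -
  interpret M: abelian_group M by fact
  interpret N: abelian_group N by fact
  note [simp] = module_homs_closed[OF h]
  have "h x = h ((x \<ominus>\<^bsub>M\<^esub> y) \<oplus>\<^bsub>M\<^esub> y)"
    using x y by (simp add: M.minus_eq M.a_assoc M.l_neg)
  also have "\<dots> = h (x \<ominus>\<^bsub>M\<^esub> y) \<oplus>\<^bsub>N\<^esub> h y"
    using x y by (simp add: module_homs_add[OF h])
  finally show ?thesis
    using x y by (simp add: N.minus_eq N.a_assoc N.r_neg)
qed

lemma module_homs_zero:
  assumes "abelian_group M" and "abelian_group N" and h: "h \<in> module_homs R M N"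
  shows "h \<zero>\<^bsub>M\<^esub> = \<zero>\<^bsub>N\<^esub>"
proof -
  interpret M: abelian_group M by fact
  interpret N: abelian_group N by fact
  note [simp] = module_homs_closed[OF h]
  have "h \<zero>\<^bsub>M\<^esub> \<oplus>\<^bsub>N\<^esub> h \<zero>\<^bsub>M\<^esub> = h \<zero>\<^bsub>M\<^esub>"
    using module_homs_add[OF h, of "\<zero>\<^bsub>M\<^esub>" "\<zero>\<^bsub>M\<^esub>"] by simp
  then show ?thesis
    using N.add.l_cancel_one by simp
qed

lemma module_self_module: "cring R \<Longrightarrow> module R (self_module R)"
proof -
  assume "cring R"
  then interpret cring R .
  have "abelian_group (self_module R)"
  proof (rule abelian_groupI)
    fix x assume "x \<in> carrier (self_module R)"
    then show "\<exists>y\<in>carrier (self_module R). y \<oplus>\<^bsub>self_module R\<^esub> x = \<zero>\<^bsub>self_module R\<^esub>"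
      by (intro bexI[of _ "\<ominus>\<^bsub>R\<^esub> x"]) (simp_all add: self_module_def l_neg)
  qed (simp_all add: self_module_def a_ac)
  then show ?thesis
    by (intro moduleI is_cring) (auto simp: self_module_def l_distr r_distr m_assoc)
qed

subsection \<open>Free modules\<close>

lemma free_module_simps:
  "\<zero>\<^bsub>free_module R S\<^esub> = (\<lambda>x. \<zero>\<^bsub>R\<^esub>)"
  "f \<oplus>\<^bsub>free_module R S\<^esub> g = (\<lambda>x. f x \<oplus>\<^bsub>R\<^esub> g x)"
  "r \<odot>\<^bsub>free_module R S\<^esub> f = (\<lambda>x. r \<otimes>\<^bsub>R\<^esub> f x)"
  by (simp_all add: free_module_def)

lemma carrier_free_module:
  "f \<in> carrier (free_module R S) \<longleftrightarrow>
    (\<forall>x\<in>S. f x \<in> carrier R) \<and> (\<forall>x. x \<notin> S \<longrightarrow> f x = \<zero>\<^bsub>R\<^esub>) \<and> finite {x. f x \<noteq> \<zero>\<^bsub>R\<^esub>}"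
  by (simp add: free_module_def)

lemma (in cring) free_module_closed:
  "f \<in> carrier (free_module R S) \<Longrightarrow> f x \<in> carrier R"
  by (cases "x \<in> S") (auto simp: carrier_free_module)

lemma (in cring) module_free_module: "module R (free_module R S)"
proof (intro moduleI is_cring abelian_groupI)
  fix f g assume f: "f \<in> carrier (free_module R S)" and g: "g \<in> carrier (free_module R S)"
  have "{x. f x \<oplus> g x \<noteq> \<zero>} \<subseteq> {x. f x \<noteq> \<zero>} \<union> {x. g x \<noteq> \<zero>}"
    using f g by (auto simp: carrier_free_module)
  then show "f \<oplus>\<^bsub>free_module R S\<^esub> g \<in> carrier (free_module R S)"
    using f g by (auto simp: carrier_free_module free_module_simps intro: finite_subset)
next
  show "\<zero>\<^bsub>free_module R S\<^esub> \<in> carrier (free_module R S)"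
    by (simp add: carrier_free_module free_module_simps)
next
  fix f assume f: "f \<in> carrier (free_module R S)"
  have "{x. \<ominus> f x \<noteq> \<zero>} \<subseteq> {x. f x \<noteq> \<zero>}"
    by auto
  then have "(\<lambda>x. \<ominus> f x) \<in> carrier (free_module R S)"
    using f by (auto simp: carrier_free_module intro: finite_subset)
  then show "\<exists>g\<in>carrier (free_module R S).
      g \<oplus>\<^bsub>free_module R S\<^esub> f = \<zero>\<^bsub>free_module R S\<^esub>"
    by (rule bexI[rotated]) (simp add: free_module_simps free_module_closed[OF f] l_neg)
next
  fix r f assume r: "r \<in> carrier R" and f: "f \<in> carrier (free_module R S)"
  have "{x. r \<otimes> f x \<noteq> \<zero>} \<subseteq> {x. f x \<noteq> \<zero>}"
    using r by auto
  then show "r \<odot>\<^bsub>free_module R S\<^esub> f \<in> carrier (free_module R S)"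
    using r f by (auto simp: carrier_free_module free_module_simps intro: finite_subset)
qed (auto simp: free_module_simps free_module_closed a_ac l_distr r_distr m_assoc)

lemma (in cring) basis_elt_closed: "x \<in> S \<Longrightarrow> basis_elt R x \<in> carrier (free_module R S)"
  using finite_subset[of "{y. y = x \<and> \<one> \<noteq> \<zero>}" "{x}"]
  by (auto simp: carrier_free_module basis_elt_def)

section \<open>Universal property of free modules\<close>

definition linear_ext ::
  "('r, 'e) ring_scheme \<Rightarrow> ('r, 'm, 'f) module_scheme \<Rightarrow> ('x \<Rightarrow> 'm) \<Rightarrow> ('x \<Rightarrow> 'r) \<Rightarrow> 'm"
  where "linear_ext R P \<phi> f = (\<Oplus>\<^bsub>P\<^esub>x\<in>{x. f x \<noteq> \<zero>\<^bsub>R\<^esub>}. f x \<odot>\<^bsub>P\<^esub> \<phi> x)"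

text \<open>The support of a sum or of a multiple can be smaller than the supports it comes from.
  Terms outside the support vanish, so all sums can be taken over one finite set and compared term
  by term.\<close>

lemma (in module) linear_ext_superset:
  assumes "finite T" and "{x. f x \<noteq> \<zero>} \<subseteq> T" and "\<And>x. f x \<in> carrier R"
    and "\<And>x. x \<in> T \<Longrightarrow> \<phi> x \<in> carrier M"
  shows "linear_ext R M \<phi> f = (\<Oplus>\<^bsub>M\<^esub>x\<in>T. f x \<odot>\<^bsub>M\<^esub> \<phi> x)"
  unfolding linear_ext_def
  using assms by (intro M.add.finprod_mono_neutral_cong_left) auto

lemma (in module) linear_ext_hom:
  assumes \<phi>: "\<And>x. x \<in> S \<Longrightarrow> \<phi> x \<in> carrier M"
  shows "restrict (linear_ext R M \<phi>) (carrier (free_module R S)) \<in> module_homs R (free_module R S) M"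
proof -
  interpret F: module R "free_module R S"
    by (rule R.module_free_module)
  let ?L = "linear_ext R M \<phi>"
  have supp: "finite {x. f x \<noteq> \<zero>}" "{x. f x \<noteq> \<zero>} \<subseteq> S" if "f \<in> carrier (free_module R S)" for f
    using that by (auto simp: carrier_free_module)
  have "?L f \<in> carrier M" if f: "f \<in> carrier (free_module R S)" for f
    unfolding linear_ext_def using supp[OF f] \<phi> R.free_module_closed[OF f]
    by (intro M.finsum_closed) auto
  moreover have "?L (f \<oplus>\<^bsub>free_module R S\<^esub> g) = ?L f \<oplus>\<^bsub>M\<^esub> ?L g"
    if f: "f \<in> carrier (free_module R S)" and g: "g \<in> carrier (free_module R S)" for f g
  proof -
    define T where "T = {x. f x \<noteq> \<zero>} \<union> {x. g x \<noteq> \<zero>}"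
    note [simp] = R.free_module_closed[OF f] R.free_module_closed[OF g]
    have T: "finite T" "T \<subseteq> S"
      using supp[OF f] supp[OF g] by (auto simp: T_def)
    then have [simp]: "\<And>x. x \<in> T \<Longrightarrow> \<phi> x \<in> carrier M"
      using \<phi> by auto
    have "?L (f \<oplus>\<^bsub>free_module R S\<^esub> g) = (\<Oplus>\<^bsub>M\<^esub>x\<in>T. (f x \<oplus> g x) \<odot>\<^bsub>M\<^esub> \<phi> x)"
      unfolding free_module_simps using T
      by (intro linear_ext_superset) (auto simp: T_def)
    also have "\<dots> = (\<Oplus>\<^bsub>M\<^esub>x\<in>T. f x \<odot>\<^bsub>M\<^esub> \<phi> x \<oplus>\<^bsub>M\<^esub> g x \<odot>\<^bsub>M\<^esub> \<phi> x)"
      by (intro M.finsum_cong') (auto simp: smult_l_distr)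
    also have "\<dots> = (\<Oplus>\<^bsub>M\<^esub>x\<in>T. f x \<odot>\<^bsub>M\<^esub> \<phi> x) \<oplus>\<^bsub>M\<^esub> (\<Oplus>\<^bsub>M\<^esub>x\<in>T. g x \<odot>\<^bsub>M\<^esub> \<phi> x)"
      by (intro M.finsum_addf) auto
    also have "(\<Oplus>\<^bsub>M\<^esub>x\<in>T. f x \<odot>\<^bsub>M\<^esub> \<phi> x) = ?L f"
      using T by (intro linear_ext_superset[symmetric]) (auto simp: T_def)
    also have "(\<Oplus>\<^bsub>M\<^esub>x\<in>T. g x \<odot>\<^bsub>M\<^esub> \<phi> x) = ?L g"
      using T by (intro linear_ext_superset[symmetric]) (auto simp: T_def)
    finally show ?thesis .
  qed
  moreover have "?L (r \<odot>\<^bsub>free_module R S\<^esub> f) = r \<odot>\<^bsub>M\<^esub> ?L f"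
    if r: "r \<in> carrier R" and f: "f \<in> carrier (free_module R S)" for r f
  proof -
    note [simp] = R.free_module_closed[OF f]
    define T where "T = {x. f x \<noteq> \<zero>}"
    have T: "finite T" "T \<subseteq> S"
      using supp[OF f] by (auto simp: T_def)
    then have [simp]: "\<And>x. x \<in> T \<Longrightarrow> \<phi> x \<in> carrier M"
      using \<phi> by auto
    have "?L (r \<odot>\<^bsub>free_module R S\<^esub> f) = (\<Oplus>\<^bsub>M\<^esub>x\<in>T. (r \<otimes> f x) \<odot>\<^bsub>M\<^esub> \<phi> x)"
      unfolding free_module_simps using T r
      by (intro linear_ext_superset) (auto simp: T_def)
    also have "\<dots> = (\<Oplus>\<^bsub>M\<^esub>x\<in>T. r \<odot>\<^bsub>M\<^esub> (f x \<odot>\<^bsub>M\<^esub> \<phi> x))"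
      using r by (intro M.finsum_cong') (auto simp: smult_assoc1)
    also have "\<dots> = r \<odot>\<^bsub>M\<^esub> ?L f"
      unfolding linear_ext_def T_def[symmetric] using T r
      by (intro finsum_smult_ldistr[symmetric]) auto
    finally show ?thesis .
  qed
  ultimately show ?thesis
    by (auto simp: module_homs_def)
qed

lemma (in module) linear_ext_basis_elt:
  assumes "x \<in> S" and "\<phi> x \<in> carrier M"
  shows "linear_ext R M \<phi> (basis_elt R x) = \<phi> x"
proof -
  have "linear_ext R M \<phi> (basis_elt R x) = (\<Oplus>\<^bsub>M\<^esub>y\<in>{x}. basis_elt R x y \<odot>\<^bsub>M\<^esub> \<phi> y)"
    using assms by (intro linear_ext_superset) (auto simp: basis_elt_def)
  then show ?thesis
    using assms by (simp add: basis_elt_def)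
qed

text \<open>Uniqueness half of the universal property, by induction on the support: setting one
  nonzero coordinate to zero shrinks the support strictly, and the term removed is a multiple of a
  basis element, where both maps agree.\<close>

lemma (in module) free_module_hom_eqI:
  assumes h: "h \<in> module_homs R (free_module R S) M" and h': "h' \<in> module_homs R (free_module R S) M"
    and eq: "\<And>x. x \<in> S \<Longrightarrow> h (basis_elt R x) = h' (basis_elt R x)"
    and f: "f \<in> carrier (free_module R S)"
  shows "h f = h' f"
proof -
  interpret F: module R "free_module R S"
    by (rule R.module_free_module)
  have "finite {x. f x \<noteq> \<zero>}"
    using f by (simp add: carrier_free_module)
  then show ?thesis
    using f
  proof (induction "{x. f x \<noteq> \<zero>}" arbitrary: f rule: finite_psubset_induct)
    case (psubset f)
    show ?case
    proof (cases "\<exists>x. f x \<noteq> \<zero>")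
      case False
      then have "f = \<zero>\<^bsub>free_module R S\<^esub>"
        by (auto simp: free_module_simps)
      then show ?thesis
        using module_homs_zero[OF F.abelian_group_axioms M.abelian_group_axioms h]
          module_homs_zero[OF F.abelian_group_axioms M.abelian_group_axioms h'] by simp
    next
      case True
      then obtain x where x: "f x \<noteq> \<zero>" by blast
      then have xS: "x \<in> S"
        using psubset.prems by (auto simp: carrier_free_module)
      note [simp] = R.free_module_closed[OF psubset.prems]
      let ?g = "f(x := \<zero>)" and ?b = "f x \<odot>\<^bsub>free_module R S\<^esub> basis_elt R x"
      have sub: "{y. ?g y \<noteq> \<zero>} \<subset> {y. f y \<noteq> \<zero>}"
        using x by auto
      moreover have g: "?g \<in> carrier (free_module R S)"
        unfolding carrier_free_module
      proof (intro conjI)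
        show "finite {y. ?g y \<noteq> \<zero>}"
          using psubset_imp_subset[OF sub] psubset.hyps(1) by (rule finite_subset)
      qed (use psubset.prems in \<open>auto simp: carrier_free_module\<close>)
      ultimately have "h ?g = h' ?g"
        using psubset.hyps(2) by blast
      have b: "basis_elt R x \<in> carrier (free_module R S)"
        by (rule R.basis_elt_closed[OF xS])
      have bc: "?b \<in> carrier (free_module R S)"
        using b by simp
      have f_eq: "f = ?g \<oplus>\<^bsub>free_module R S\<^esub> ?b"
        by (auto simp: free_module_simps basis_elt_def)
      have "h f = h ?g \<oplus>\<^bsub>M\<^esub> h ?b"
        by (subst f_eq) (rule module_homs_add[OF h g bc])
      also have "\<dots> = h' ?g \<oplus>\<^bsub>M\<^esub> h' ?b"
        using \<open>h ?g = h' ?g\<close> eq[OF xS] by (simp add: module_homs_smult[OF h _ b] module_homs_smult[OF h' _ b])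
      also have "\<dots> = h' f"
        by (subst (3) f_eq) (rule module_homs_add[OF h' g bc, symmetric])
      finally show ?thesis .
    qed
  qed
qed

subsection \<open>Quotient modules\<close>

lemma (in module) submodule_submodule_gen:
  assumes "G \<subseteq> carrier M"
  shows "submodule (submodule_gen R M G) R M"
proof (rule submoduleI)
  \<comment> \<open>The intersection stays inside the carrier because the carrier is itself one of
    the submodules containing \<open>G\<close>.\<close>
  show "submodule_gen R M G \<subseteq> carrier M"
    using assms carrier_is_submodule by (auto simp: submodule_gen_def)
  show "\<zero>\<^bsub>M\<^esub> \<in> submodule_gen R M G"
    using submodule.axioms(1) subgroup.one_closed by (fastforce simp: submodule_gen_def)
qed (simp_all add: submodule_gen_def submoduleE(3-5))

lemma submodule_gen_superset: "G \<subseteq> submodule_gen R M G"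
  by (auto simp: submodule_gen_def)

lemma submodule_gen_minimal: "submodule N R M \<Longrightarrow> G \<subseteq> N \<Longrightarrow> submodule_gen R M G \<subseteq> N"
  by (auto simp: submodule_gen_def)

lemma (in module) submodule_kernel:
  assumes "module R P" and h: "h \<in> module_homs R M P"
  shows "submodule {x \<in> carrier M. h x = \<zero>\<^bsub>P\<^esub>} R M"
proof -
  interpret P: module R P by fact
  note zero = module_homs_zero[OF M.abelian_group_axioms P.abelian_group_axioms h]
  show ?thesis
  proof (rule submoduleI)
    fix x assume "x \<in> {x \<in> carrier M. h x = \<zero>\<^bsub>P\<^esub>}"
    then show "\<ominus>\<^bsub>M\<^esub> x \<in> {x \<in> carrier M. h x = \<zero>\<^bsub>P\<^esub>}"
      using module_homs_minus[OF M.abelian_group_axioms P.abelian_group_axioms h, of "\<zero>\<^bsub>M\<^esub>" x] zero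
      by (auto simp: M.minus_eq P.minus_eq)
  qed (auto simp: zero module_homs_add[OF h] module_homs_smult[OF h])
qed

lemma (in module) abelian_subgroup_submodule: "submodule K R M \<Longrightarrow> abelian_subgroup K M"
  by (intro abelian_subgroupI3 M.abelian_group_axioms additive_subgroupI submodule.axioms(1))

lemma (in module) quot_module_carrier:
  "carrier (quot_module M K) = (\<lambda>x. K +>\<^bsub>M\<^esub> x) ` carrier M"
  by (auto simp: quot_module_def A_RCOSETS_def' a_r_coset_def')

lemma (in module) quot_module_add:
  assumes "submodule K R M" "x \<in> carrier M" "y \<in> carrier M"
  shows "(K +>\<^bsub>M\<^esub> x) \<oplus>\<^bsub>quot_module M K\<^esub> (K +>\<^bsub>M\<^esub> y) = K +>\<^bsub>M\<^esub> (x \<oplus>\<^bsub>M\<^esub> y)"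
  using abelian_subgroup.a_rcos_sum[OF abelian_subgroup_submodule] assms
  by (simp add: quot_module_def)

lemma (in module) abelian_group_quot_module:
  assumes K: "submodule K R M"
  shows "abelian_group (quot_module M K)"
proof -
  interpret K: abelian_subgroup K M
    by (rule abelian_subgroup_submodule) fact
  have zero: "\<zero>\<^bsub>quot_module M K\<^esub> = K +>\<^bsub>M\<^esub> \<zero>\<^bsub>M\<^esub>"
    by (simp add: quot_module_def K.a_rcos_const)
  show ?thesis
  proof (rule abelian_groupI)
    fix a assume "a \<in> carrier (quot_module M K)"
    then obtain x where x: "a = K +>\<^bsub>M\<^esub> x" "x \<in> carrier M"
      by (auto simp: quot_module_carrier)
    then have "K +>\<^bsub>M\<^esub> (\<ominus>\<^bsub>M\<^esub> x) \<in> carrier (quot_module M K)"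
      by (simp add: quot_module_carrier)
    then show "\<exists>b\<in>carrier (quot_module M K). b \<oplus>\<^bsub>quot_module M K\<^esub> a = \<zero>\<^bsub>quot_module M K\<^esub>"
      by (rule bexI[rotated]) (simp add: x quot_module_add[OF K] zero M.l_neg)
  qed (auto simp: quot_module_carrier quot_module_add[OF K] zero M.a_ac)
qed

lemma (in module) coset_eq_iff:
  assumes "submodule K R M" "x \<in> carrier M" "y \<in> carrier M"
  shows "K +>\<^bsub>M\<^esub> x = K +>\<^bsub>M\<^esub> y \<longleftrightarrow> x \<ominus>\<^bsub>M\<^esub> y \<in> K"
proof -
  interpret K: abelian_subgroup K M
    by (rule abelian_subgroup_submodule) fact
  show ?thesis
    using K.a_rcos_module[OF assms(3,2)] K.a_repr_independence'[of x y]
      K.a_repr_independenceD[of x y] assms(2,3)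
    by (metis K.a_rcos_self M.minus_eq)
qed

text \<open>The scalar multiplication of the quotient is a union over all representatives of the
  class. Every representative contributes the same coset, and there is at least one, so the union
  collapses to that coset.\<close>

lemma (in module) quot_module_smult:
  assumes K: "submodule K R M" and r: "r \<in> carrier R" and x: "x \<in> carrier M"
  shows "r \<odot>\<^bsub>quot_module M K\<^esub> (K +>\<^bsub>M\<^esub> x) = K +>\<^bsub>M\<^esub> (r \<odot>\<^bsub>M\<^esub> x)"
proof -
  interpret K: abelian_subgroup K M
    by (rule abelian_subgroup_submodule) fact
  have "K +>\<^bsub>M\<^esub> (r \<odot>\<^bsub>M\<^esub> y) = K +>\<^bsub>M\<^esub> (r \<odot>\<^bsub>M\<^esub> x)" if y: "y \<in> K +>\<^bsub>M\<^esub> x" for y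
  proof -
    obtain z where z: "z \<in> K" "y = z \<oplus>\<^bsub>M\<^esub> x"
      using y by (auto simp: a_r_coset_def')
    then have zM: "z \<in> carrier M"
      by simp
    have "r \<odot>\<^bsub>M\<^esub> y = r \<odot>\<^bsub>M\<^esub> z \<oplus>\<^bsub>M\<^esub> r \<odot>\<^bsub>M\<^esub> x"
      using z(2) zM r x by (simp add: smult_r_distr)
    then have "r \<odot>\<^bsub>M\<^esub> y \<in> K +>\<^bsub>M\<^esub> (r \<odot>\<^bsub>M\<^esub> x)"
      using submodule.smult_closed[OF K r z(1)] by (auto simp: a_r_coset_def')
    then show ?thesis
      using r x K.a_repr_independence' by auto
  qed
  moreover have "K +>\<^bsub>M\<^esub> x \<noteq> {}"
    using K.a_rcos_self[OF x] by blast
  ultimately show ?thesis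
    unfolding quot_module_def by (simp add: SUP_eq_const)
qed

lemma (in module) module_homs_quot_comp:
  assumes K: "submodule K R M" and P: "module R P" and h: "h \<in> module_homs R (quot_module M K) P"
  shows "(\<lambda>x\<in>carrier M. h (K +>\<^bsub>M\<^esub> x)) \<in> module_homs R M P"
    and "\<And>x. x \<in> K \<Longrightarrow> h (K +>\<^bsub>M\<^esub> x) = \<zero>\<^bsub>P\<^esub>"
proof -
  interpret P: module R P by fact
  interpret K: abelian_subgroup K M
    by (rule abelian_subgroup_submodule) fact
  have cl: "K +>\<^bsub>M\<^esub> x \<in> carrier (quot_module M K)" if "x \<in> carrier M" for x
    using that by (simp add: quot_module_carrier)
  show hom: "(\<lambda>x\<in>carrier M. h (K +>\<^bsub>M\<^esub> x)) \<in> module_homs R M P"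
    using module_homs_closed[OF h cl] module_homs_add[OF h cl cl] module_homs_smult[OF h _ cl]
    by (auto simp: module_homs_def quot_module_add[OF K] quot_module_smult[OF K])
  fix x assume x: "x \<in> K"
  then have "K +>\<^bsub>M\<^esub> x = K +>\<^bsub>M\<^esub> \<zero>\<^bsub>M\<^esub>"
    by (simp add: K.a_rcos_const K.zero_closed)
  then show "h (K +>\<^bsub>M\<^esub> x) = \<zero>\<^bsub>P\<^esub>"
    using module_homs_zero[OF M.abelian_group_axioms P.abelian_group_axioms hom] by simp
qed

text \<open>The kernel of \<open>h\<close> is a submodule containing \<open>G\<close>, hence it
  contains everything that \<open>G\<close> generates. Therefore \<open>h\<close> takes the same
  value on all representatives of a class, and the induced map can be defined through an arbitrary
  choice \<open>s\<close> of representatives.\<close>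

lemma (in module) ex_module_homs_quot:
  assumes P: "module R P" and h: "h \<in> module_homs R M P"
    and G: "G \<subseteq> carrier M" and hG: "\<And>x. x \<in> G \<Longrightarrow> h x = \<zero>\<^bsub>P\<^esub>"
  shows "\<exists>h' \<in> module_homs R (quot_module M (submodule_gen R M G)) P.
    \<forall>x\<in>carrier M. h' (submodule_gen R M G +>\<^bsub>M\<^esub> x) = h x"
proof -
  interpret P: module R P by fact
  let ?K = "submodule_gen R M G"
  let ?Q = "quot_module M ?K"
  have K: "submodule ?K R M"
    by (rule submodule_submodule_gen) fact
  have ker: "h x = \<zero>\<^bsub>P\<^esub>" if "x \<in> ?K" for x
    using that submodule_gen_minimal[OF submodule_kernel[OF P h], of G] G hG by auto
  have "\<exists>x\<in>carrier M. c = ?K +>\<^bsub>M\<^esub> x" if "c \<in> carrier ?Q" for c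
    using that by (auto simp: quot_module_carrier)
  then obtain s where s: "\<And>c. c \<in> carrier ?Q \<Longrightarrow> s c \<in> carrier M \<and> c = ?K +>\<^bsub>M\<^esub> s c"
    by metis
  define h' where "h' = (\<lambda>c\<in>carrier ?Q. h (s c))"
  have h': "h' (?K +>\<^bsub>M\<^esub> x) = h x" if x: "x \<in> carrier M" for x
  proof -
    have cl: "?K +>\<^bsub>M\<^esub> x \<in> carrier ?Q"
      using x by (simp add: quot_module_carrier)
    let ?y = "s (?K +>\<^bsub>M\<^esub> x)"
    have y: "?y \<in> carrier M" "?K +>\<^bsub>M\<^esub> x = ?K +>\<^bsub>M\<^esub> ?y"
      using s[OF cl] by auto
    then have "h (?y \<ominus>\<^bsub>M\<^esub> x) = \<zero>\<^bsub>P\<^esub>"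
      using ker coset_eq_iff[OF K y(1) x] by simp
    then have "h ?y = h x"
      using module_homs_minus[OF M.abelian_group_axioms P.abelian_group_axioms h y(1) x]
        module_homs_closed[OF h] x y(1) by (simp add: P.minus_eq P.minus_equality P.r_neg P.add.inv_solve_right')
    then show ?thesis
      using cl by (simp add: h'_def)
  qed
  have "h' \<in> module_homs R ?Q P"
    unfolding module_homs_def
  proof (intro CollectI conjI ballI)
    show "h' \<in> carrier ?Q \<rightarrow>\<^sub>E carrier P"
      using s module_homs_closed[OF h] by (auto simp: h'_def)
  next
    fix a b assume "a \<in> carrier ?Q" "b \<in> carrier ?Q"
    then obtain x y where "a = ?K +>\<^bsub>M\<^esub> x" "b = ?K +>\<^bsub>M\<^esub> y" "x \<in> carrier M" "y \<in> carrier M"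
      by (auto simp: quot_module_carrier)
    then show "h' (a \<oplus>\<^bsub>?Q\<^esub> b) = h' a \<oplus>\<^bsub>P\<^esub> h' b"
      by (simp add: quot_module_add[OF K] h' module_homs_add[OF h])
  next
    fix r a assume "r \<in> carrier R" "a \<in> carrier ?Q"
    moreover from this obtain x where "a = ?K +>\<^bsub>M\<^esub> x" "x \<in> carrier M"
      by (auto simp: quot_module_carrier)
    ultimately show "h' (r \<odot>\<^bsub>?Q\<^esub> a) = r \<odot>\<^bsub>P\<^esub> h' a"
      by (simp add: quot_module_smult[OF K] h' module_homs_smult[OF h])
  qed
  then show ?thesis
    using h' by blast
qed

section \<open>The binomial theorem modulo a prime\<close>

theorem (in cring) binomial:
  assumes a: "a \<in> carrier R" and b: "b \<in> carrier R"
  shows "(a \<oplus> b) [^] n = (\<Oplus>i\<in>{..n}. [(n choose i)] \<cdot> (a [^] i \<otimes> b [^] (n - i)))"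
proof (induction n)
  case 0
  then show ?case using a b by simp
next
  case (Suc n)
  let ?t = "\<lambda>n i. [(n choose i)] \<cdot> (a [^] i \<otimes> b [^] (n - i))"
  let ?u = "\<lambda>i. [(n choose i)] \<cdot> (a [^] i \<otimes> b [^] (Suc n - i))"
  let ?v = "\<lambda>i. [(n choose i)] \<cdot> (a [^] Suc i \<otimes> b [^] (n - i))"
  have u: "?t n i \<otimes> b = ?u i" and v: "?t n i \<otimes> a = ?v i" if "i \<le> n" for i
    using that a b by (simp_all add: add_pow_ldistr add_pow_rdistr Suc_diff_le m_ac)
  have "(a \<oplus> b) [^] Suc n = (\<Oplus>i\<in>{..n}. ?t n i) \<otimes> a \<oplus> (\<Oplus>i\<in>{..n}. ?t n i) \<otimes> b"
    using a b Suc by (simp add: r_distr)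
  also have "(\<Oplus>i\<in>{..n}. ?t n i) \<otimes> b = (\<Oplus>i\<in>{..n}. ?u i)"
    using a b u by (subst finsum_ldistr) (auto intro!: finsum_cong')
  \<comment> \<open>The added term has coefficient n choose n+1, which is 0. After the shift of
    index that follows, \<open>?u (Suc i)\<close> and \<open>?v i\<close> carry the same monomial,
    and Pascal's rule adds their coefficients.\<close>
  also have "\<dots> = (\<Oplus>i\<in>{..Suc n}. ?u i)"
    using a b by (subst finsum_Suc) (auto simp: binomial_eq_0)
  also have "\<dots> = (\<Oplus>i\<in>{..n}. ?u (Suc i)) \<oplus> ?u 0"
    using a b by (subst finsum_Suc2) auto
  also have "(\<Oplus>i\<in>{..n}. ?t n i) \<otimes> a = (\<Oplus>i\<in>{..n}. ?v i)"
    using a b v by (subst finsum_ldistr) (auto intro!: finsum_cong')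
  also have "(\<Oplus>i\<in>{..n}. ?v i) \<oplus> ((\<Oplus>i\<in>{..n}. ?u (Suc i)) \<oplus> ?u 0)
      = (\<Oplus>i\<in>{..n}. ?v i \<oplus> ?u (Suc i)) \<oplus> ?u 0"
    using a b by (subst finsum_addf) (auto simp: a_assoc)
  also have "(\<Oplus>i\<in>{..n}. ?v i \<oplus> ?u (Suc i)) = (\<Oplus>i\<in>{..n}. ?t (Suc n) (Suc i))"
    using a b by (intro finsum_cong') (auto simp: add.nat_pow_mult)
  also have "\<dots> \<oplus> ?u 0 = (\<Oplus>i\<in>{..Suc n}. ?t (Suc n) i)"
    using a b by (subst finsum_Suc2) auto
  finally show ?case .
qed

lemma (in abelian_group) finsum_nat_smult:
  assumes "f \<in> A \<rightarrow> carrier G"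
  shows "[(n::nat)] \<cdot> (\<Oplus>i\<in>A. f i) = (\<Oplus>i\<in>A. [n] \<cdot> f i)"
  using assms by (induction n) (simp_all add: Pi_def)

lemma (in cring) Cp_closed [simp]:
  "a \<in> carrier R \<Longrightarrow> b \<in> carrier R \<Longrightarrow> Cp p R a b \<in> carrier R"
  by (simp add: Cp_def)

text \<open>For 0 < i < p the prime p divides p choose i, so multiplying by p undoes the integer
  division in \<open>Cp\<close> and yields the middle terms of the binomial expansion. The identity
  holds in every commutative ring, whether or not p can be cancelled there.\<close>

lemma (in cring) p_times_Cp:
  assumes p: "prime p" and a: "a \<in> carrier R" and b: "b \<in> carrier R"
  shows "[p] \<cdot> Cp p R a b = a [^] p \<oplus> b [^] p \<ominus> (a \<oplus> b) [^] p"
proof -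
  let ?t = "\<lambda>i. [(p choose i)] \<cdot> (a [^] i \<otimes> b [^] (p - i))"
  have p0: "p > 0" using p by (simp add: prime_gt_0_nat)
  have t: "?t i \<in> carrier R" for i using a b by simp
  have "[p] \<cdot> (\<Oplus>i\<in>{1..<p}. [((p choose i) div p)] \<cdot> (a [^] i \<otimes> b [^] (p - i)))
      = (\<Oplus>i\<in>{1..<p}. [p] \<cdot> ([((p choose i) div p)] \<cdot> (a [^] i \<otimes> b [^] (p - i))))"
    using a b by (intro finsum_nat_smult) auto
  also have "\<dots> = (\<Oplus>i\<in>{1..<p}. ?t i)"
  proof (intro finsum_cong')
    fix i assume i: "i \<in> {1..<p}"
    then have "p dvd (p choose i)"
      using p by (intro dvd_choose_prime) auto
    then show "[p] \<cdot> ([((p choose i) div p)] \<cdot> (a [^] i \<otimes> b [^] (p - i))) = ?t i"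
      using a b by (subst add.nat_pow_pow) auto
  qed (use t in auto)
  finally have 1: "[p] \<cdot> Cp p R a b = \<ominus> (\<Oplus>i\<in>{1..<p}. ?t i)"
    using a b by (simp add: Cp_def add.nat_pow_inv)
  have "{..p} = insert 0 (insert p {1..<p})"
    using p0 by auto
  then have "(a \<oplus> b) [^] p = b [^] p \<oplus> (a [^] p \<oplus> (\<Oplus>i\<in>{1..<p}. ?t i))"
    using p0 t a b by (simp add: binomial Pi_def del: add.nat_pow_closed)
  then show ?thesis
    using t a b unfolding 1
    by (simp add: minus_eq minus_add a_ac r_neg2 r_neg1 r_neg l_neg Pi_def finsum_closed)
qed

section \<open>Special values of C_p, which is the carry in the addition of Witt vectors\<close>

lemma (in cring) Cp_zero_left [simp]: "b \<in> carrier R \<Longrightarrow> Cp p R \<zero> b = \<zero>"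
proof -
  assume b: "b \<in> carrier R"
  have "(\<Oplus>i\<in>{1..<p}. [((p choose i) div p)] \<cdot> (\<zero> [^] i \<otimes> b [^] (p - i))) = (\<Oplus>i\<in>{1..<p}. \<zero>)"
    using b by (intro finsum_cong') (auto simp: nat_pow_zero)
  then show ?thesis
    by (simp add: Cp_def)
qed

lemma (in cring) nat_one_power: "([n] \<cdot> \<one>) [^] m = [(n ^ m :: nat)] \<cdot> \<one>"
  by (induction m) (simp_all add: add_pow_ldistr add.nat_pow_pow mult.commute)

lemma (in cring) finsum_nat_one:
  "finite A \<Longrightarrow> (\<Oplus>i\<in>A. [(f i :: nat)] \<cdot> \<one>) = [(\<Sum>i\<in>A. f i)] \<cdot> \<one>"
  by (induction A rule: finite_induct) (simp_all add: add.nat_pow_mult)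

text \<open>This is the carry that arises when the unit of W_2(k) is added to its n-fold
  multiple.\<close>

lemma (in cring) Cp_nat_one:
  "Cp p R ([n] \<cdot> \<one>) \<one> = \<ominus> ([(\<Sum>i\<in>{1..<p}. ((p choose i) div p) * n ^ i)] \<cdot> \<one>)"
proof -
  have "(\<Oplus>i\<in>{1..<p}. [((p choose i) div p)] \<cdot> (([n] \<cdot> \<one>) [^] i \<otimes> \<one> [^] (p - i)))
      = (\<Oplus>i\<in>{1..<p}. [(((p choose i) div p) * n ^ i)] \<cdot> \<one>)"
    by (intro finsum_cong') (auto simp: nat_one_power add.nat_pow_pow mult.commute)
  then show ?thesis
    by (simp add: Cp_def finsum_nat_one)
qed

text \<open>The binomial expansion of (n + 1)^p with its two outer terms split off. It is stated for
  natural numbers so that p can be cancelled later, which is impossible in k.\<close>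

lemma sum_choose_div_prime:
  assumes p: "prime p"
  shows "p * (\<Sum>i\<in>{1..<p}. ((p choose i) div p) * n ^ i) + n ^ p + 1 = (n + 1) ^ p"
proof -
  have p0: "p > 0" using p by (simp add: prime_gt_0_nat)
  have "p * (\<Sum>i\<in>{1..<p}. ((p choose i) div p) * n ^ i) = (\<Sum>i\<in>{1..<p}. (p choose i) * n ^ i)"
    unfolding sum_distrib_left
  proof (rule sum.cong)
    fix i assume "i \<in> {1..<p}"
    then have "p dvd (p choose i)"
      using p by (intro dvd_choose_prime) auto
    then show "p * (((p choose i) div p) * n ^ i) = (p choose i) * n ^ i"
      by (metis dvd_mult_div_cancel mult.assoc)
  qed simp
  moreover have "{..p} = insert 0 (insert p {1..<p})"
    using p0 by auto
  ultimately show ?thesis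
    using p0 Binomial.binomial[of n 1 p] by simp
qed

section \<open>Fields of characteristic \<open>p\<close> and their Witt vectors of length 2\<close>

lemma prime_ring_char:
  assumes "domain k" and "ring_char k = p" and "p > 0"
  shows "prime p" and "[p] \<cdot>\<^bsub>k\<^esub> \<one>\<^bsub>k\<^esub> = \<zero>\<^bsub>k\<^esub>"
proof -
  interpret domain k by fact
  let ?P = "\<lambda>n::nat. 0 < n \<and> [n] \<cdot>\<^bsub>k\<^esub> \<one>\<^bsub>k\<^esub> = \<zero>\<^bsub>k\<^esub>"
  have ex: "\<exists>n. ?P n" and p: "p = (LEAST n. ?P n)"
    using assms(2,3) by (auto simp: ring_char_def split: if_splits)
  show p0: "[p] \<cdot>\<^bsub>k\<^esub> \<one>\<^bsub>k\<^esub> = \<zero>\<^bsub>k\<^esub>"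
    using LeastI_ex[OF ex] p by auto
  have least: "p \<le> n" if "?P n" for n
    unfolding p using that by (rule Least_le)
  show "prime p"
    unfolding prime_nat_iff
  proof (intro conjI allI impI)
    have "p \<noteq> 1"
      using p0 by auto
    then show "1 < p"
      using assms(3) by simp
    fix m assume "m dvd p"
    then obtain n where mn: "p = m * n" by blast
    have "([m] \<cdot>\<^bsub>k\<^esub> \<one>\<^bsub>k\<^esub>) \<otimes>\<^bsub>k\<^esub> ([n] \<cdot>\<^bsub>k\<^esub> \<one>\<^bsub>k\<^esub>) = [p] \<cdot>\<^bsub>k\<^esub> \<one>\<^bsub>k\<^esub>"
      by (simp add: mn add_pow_ldistr add.nat_pow_pow mult.commute)
    then have "[m] \<cdot>\<^bsub>k\<^esub> \<one>\<^bsub>k\<^esub> = \<zero>\<^bsub>k\<^esub> \<or> [n] \<cdot>\<^bsub>k\<^esub> \<one>\<^bsub>k\<^esub> = \<zero>\<^bsub>k\<^esub>"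
      using p0 integral_iff by simp
    moreover have "m > 0" "n > 0"
      using mn assms(3) by auto
    ultimately have "p \<le> m \<or> p \<le> n"
      using least[of m] least[of n] by blast
    then have "n \<le> 1 \<or> m \<le> 1"
      using \<open>m > 0\<close> \<open>n > 0\<close> unfolding mn by auto
    then show "m = 1 \<or> m = p"
      using \<open>m > 0\<close> \<open>n > 0\<close> mn by (auto simp: le_Suc_eq)
  qed
qed

lemma (in abelian_group) add_minus_cancel: "x \<in> carrier G \<Longrightarrow> y \<in> carrier G \<Longrightarrow> (x \<oplus> y) \<ominus> y = x"
  by (simp add: minus_eq a_assoc r_neg)

lemma (in abelian_group) minus_eq_zero_iff:
  assumes "x \<in> carrier G" and "y \<in> carrier G"
  shows "x \<ominus> y = \<zero> \<longleftrightarrow> x = y"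
proof
  assume "x \<ominus> y = \<zero>"
  moreover have "x = (x \<ominus> y) \<oplus> y"
    using assms by (simp add: minus_eq a_assoc l_neg)
  ultimately show "x = y"
    using assms by simp
qed (use assms in \<open>simp add: minus_eq r_neg\<close>)

text \<open>The ring axioms of W_2(k) enter as an assumption. In the final theorem they are read off
  from the hypothesis that A is an algebra over W_2(k), so the associativity of Witt addition is
  never computed.\<close>

locale witt_field = field k for k :: "('k, 'e) ring_scheme" (structure) and p :: nat +
  assumes prime_p: "prime p" and char_p: "[p] \<cdot> \<one> = \<zero>"
    and cring_W2: "cring (W2 p k)"
begin

abbreviation "W \<equiv> W2 p k"

sublocale W: cring W
  by (rule cring_W2)

lemma p_gt_0: "p > 0"
  using prime_p by (simp add: prime_gt_0_nat)

lemma p_smult_zero [simp]: "x \<in> carrier k \<Longrightarrow> [p] \<cdot> x = \<zero>"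
  using add_pow_ldistr[of \<one> x p] char_p by simp

lemma frob_add: "x \<in> carrier k \<Longrightarrow> y \<in> carrier k \<Longrightarrow> (x \<oplus> y) [^] p = x [^] p \<oplus> y [^] p"
  using p_times_Cp[OF prime_p, of x y, symmetric] by simp

text \<open>The Frobenius of k is additive, so (x - y)^p = 0, and a field has no nonzero nilpotents.
  Injectivity is all that remains of perfectness here, and it is used both to identify
  \<open>frob_quotient\<close> and to embed k into W_2(k).\<close>

lemma frob_inj:
  assumes x: "x \<in> carrier k" and y: "y \<in> carrier k" and eq: "x [^] p = y [^] p"
  shows "x = y"
proof -
  have "x [^] p = ((x \<ominus> y) \<oplus> y) [^] p"
    using x y by (simp add: minus_eq a_assoc l_neg)
  also have "\<dots> = (x \<ominus> y) [^] p \<oplus> x [^] p"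
    using x y by (simp add: frob_add eq)
  finally have "(x \<ominus> y) [^] p = \<zero>"
    using x y add.r_cancel_one by simp
  moreover have "z = \<zero>" if "z [^] n = \<zero>" "z \<in> carrier k" for z and n :: nat
    using that by (induction n) (auto simp: integral_iff)
  ultimately have "x \<ominus> y = \<zero>"
    using x y by blast
  then show ?thesis
    using x y by simp
qed

section \<open>Arithmetic in Witt coordinates\<close>

lemma W2_simps [simp]:
  "carrier W = carrier k \<times> carrier k"
  "\<zero>\<^bsub>W\<^esub> = (\<zero>, \<zero>)"
  "\<one>\<^bsub>W\<^esub> = (\<one>, \<zero>)"
  "(x0, x1) \<oplus>\<^bsub>W\<^esub> (y0, y1) = (x0 \<oplus> y0, x1 \<oplus> y1 \<oplus> Cp p k x0 y0)"
  "(x0, x1) \<otimes>\<^bsub>W\<^esub> (y0, y1) =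
    (x0 \<otimes> y0, x0 [^] p \<otimes> y1 \<oplus> y0 [^] p \<otimes> x1 \<oplus> [p] \<cdot> (x1 \<otimes> y1))"
  by (simp_all add: W2_def)

text \<open>Passing from m to m + 1 adds the carry C_p(m, 1) to the second coordinate, and the
  carries accumulate.\<close>

lemma W2_nat_one:
  "[n] \<cdot>\<^bsub>W\<^esub> \<one>\<^bsub>W\<^esub> =
    ([n] \<cdot> \<one>, \<ominus> ([(\<Sum>m<n. \<Sum>i\<in>{1..<p}. ((p choose i) div p) * m ^ i)] \<cdot> \<one>))"
  by (induction n)
    (simp_all add: Cp_nat_one add.nat_pow_mult[symmetric] minus_add)

text \<open>The integers D(m) = ((m+1)^p - m^p - 1)/p telescope: p times the sum of the D(m) for m <
  n equals n^p - n. At n = p, cancelling p in the naturals gives the sum p^(p-1) - 1, which becomes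
  -1 in k because p - 1 > 0. In ghost components this is the equation p = 0^p + p * 1 modulo
  p^p.\<close>

lemma W2_p_one: "[p] \<cdot>\<^bsub>W\<^esub> \<one>\<^bsub>W\<^esub> = (\<zero>, \<one>)"
proof -
  let ?D = "\<lambda>m. \<Sum>i\<in>{1..<p}. ((p choose i) div p) * m ^ i"
  have "p * (\<Sum>m<n. ?D m) + n = n ^ p" for n
  proof (induction n)
    case 0
    then show ?case using p_gt_0 by simp
  next
    case (Suc n)
    then show ?case
      using sum_choose_div_prime[OF prime_p, of n] by (simp add: algebra_simps)
  qed
  from this[of p] have "p * ((\<Sum>m<p. ?D m) + 1) = p * (p ^ (p - 1))"
    using p_gt_0 by (simp add: power_eq_if)
  then have "(\<Sum>m<p. ?D m) + 1 = p ^ (p - 1)"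
    by (rule nat_mult_eq_cancel1[OF p_gt_0, THEN iffD1])
  moreover have "[(p ^ (p - 1))] \<cdot> \<one> = \<zero>"
    using prime_gt_1_nat[OF prime_p] by (simp add: nat_one_power[symmetric] char_p nat_pow_zero)
  ultimately have "[Suc (\<Sum>m<p. ?D m)] \<cdot> \<one> = \<zero>"
    by (simp only: Suc_eq_plus1)
  then have "[(\<Sum>m<p. ?D m)] \<cdot> \<one> \<oplus> \<one> = \<zero>"
    by simp
  then have "\<ominus> ([(\<Sum>m<p. ?D m)] \<cdot> \<one>) = \<one>"
    by (intro minus_equality) (simp_all add: a_comm)
  then show ?thesis
    unfolding W2_nat_one char_p by simp
qed

text \<open>The product with (0, 1) forgets the second coordinate. So the kernel of multiplication
  by p is that of the residue map \<open>fst\<close>, and the image consists of the pairs (0,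
  y^p).\<close>

lemma W2_p_times:
  assumes "x \<in> carrier W"
  shows "[p] \<cdot>\<^bsub>W\<^esub> x = (\<zero>, fst x [^] p)"
proof -
  have "[p] \<cdot>\<^bsub>W\<^esub> x = ([p] \<cdot>\<^bsub>W\<^esub> \<one>\<^bsub>W\<^esub>) \<otimes>\<^bsub>W\<^esub> x"
    using assms W.add_pow_ldistr[of "\<one>\<^bsub>W\<^esub>" x p] 
    by (simp only: W.l_one W.one_closed)
  also have "\<dots> = (\<zero>, fst x [^] p)"
    using assms p_gt_0 unfolding W2_p_one by (cases x) (simp add: nat_pow_zero)
  finally show ?thesis .
qed

text \<open>Since p = 0 in k, the second coordinate of a product obeys a Leibniz rule twisted by the
  Frobenius. Hence the second coordinate of x^n carries the factor n, which is zero at n = p. The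
  induction runs over \<open>Suc n\<close> to avoid the exponent n - 1.\<close>

lemma W2_power_p:
  assumes "x \<in> carrier W"
  shows "x [^]\<^bsub>W\<^esub> p = (fst x [^] p, \<zero>)"
proof -
  obtain a b where x: "x = (a, b)" "a \<in> carrier k" "b \<in> carrier k"
    using assms by (cases x) auto
  have "x [^]\<^bsub>W\<^esub> Suc n = (a [^] Suc n, [Suc n] \<cdot> ((a [^] n) [^] p \<otimes> b))" for n
  proof (induction n)
    case 0
    then show ?case using x by simp
  next
    case (Suc n)
    have "(a [^] Suc n) [^] p = a [^] p \<otimes> (a [^] n) [^] p"
      using x by (simp add: nat_pow_distrib m_comm)
    then show ?case
      using Suc x unfolding W.nat_pow_Suc[of _ "Suc n"]
      by (simp add: add_pow_rdistr r_distr m_ac a_ac)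
  qed
  from this[of "p - 1"] show ?thesis
    using x p_gt_0 by simp
qed

text \<open>For r = (a, b) the difference of phi(r) = (a^p, b^p) and r^p = (a^p, 0) is (0, b^p),
  which is p times any lift of b. Injectivity of the Frobenius leaves b as the only candidate for
  the definite description.\<close>

lemma frob_quotient_eq:
  assumes r: "r \<in> carrier W"
  shows "frob_quotient p k r = snd r"
proof -
  obtain a b where ab: "r = (a, b)" "a \<in> carrier k" "b \<in> carrier k"
    using r by (cases r) auto
  \<comment> \<open>The summand (0, b^p) stands on the left so that the carry is C_p(0, a^p) =
    0.\<close>
  have "W2_frob p k r = (\<zero>, b [^] p) \<oplus>\<^bsub>W\<^esub> r [^]\<^bsub>W\<^esub> p"
    using ab by (simp add: W2_power_p W2_frob_def)
  moreover have "(\<zero>, b [^] p) \<in> carrier W" "r [^]\<^bsub>W\<^esub> p \<in> carrier W"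
    using ab W.nat_pow_closed[OF r] by simp_all
  ultimately have diff: "W2_frob p k r \<ominus>\<^bsub>W\<^esub> r [^]\<^bsub>W\<^esub> p = (\<zero>, b [^] p)"
    by (simp only: W.add_minus_cancel)
  show ?thesis
    unfolding frob_quotient_def diff
  proof (rule the_equality)
    show "snd r \<in> carrier k \<and> (\<forall>x'\<in>carrier W. fst x' = snd r \<longrightarrow> [p] \<cdot>\<^bsub>W\<^esub> x' = (\<zero>, b [^] p))"
      using ab W2_p_times by auto
  next
    fix x assume x: "x \<in> carrier k \<and> (\<forall>x'\<in>carrier W. fst x' = x \<longrightarrow> [p] \<cdot>\<^bsub>W\<^esub> x' = (\<zero>, b [^] p))"
    then have "[p] \<cdot>\<^bsub>W\<^esub> (x, \<zero>) = (\<zero>, b [^] p)" by simp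
    then have "x [^] p = b [^] p"
      using W2_p_times[of "(x, \<zero>)"] x by simp
    then show "x = snd r"
      using frob_inj[of x b] x ab by simp
  qed
qed

end

section \<open>Restriction of scalars, tensors and flatness\<close>

text \<open>It serves to view A_0 as a module over W_2(k) through the residue map, as the target of
  a bilinear map.\<close>

definition restrict_scalars ::
  "('r \<Rightarrow> 's) \<Rightarrow> ('s, 'm, 'f) module_scheme \<Rightarrow> ('r, 'm) module"
  where "restrict_scalars \<phi> M =
    \<lparr>carrier = carrier M, monoid.mult = monoid.mult M, one = one M, zero = zero M, add = add M,
     smult = (\<lambda>r x. \<phi> r \<odot>\<^bsub>M\<^esub> x)\<rparr>"

lemma module_restrict_scalars:
  assumes "cring R" and "\<phi> \<in> ring_hom R S" and "module S M"
  shows "module R (restrict_scalars \<phi> M)"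
proof -
  interpret R: cring R by fact
  interpret M: module S M by fact
  have "abelian_group (restrict_scalars \<phi> M)"
  proof (rule abelian_groupI)
    fix x assume "x \<in> carrier (restrict_scalars \<phi> M)"
    then show "\<exists>y\<in>carrier (restrict_scalars \<phi> M).
        y \<oplus>\<^bsub>restrict_scalars \<phi> M\<^esub> x = \<zero>\<^bsub>restrict_scalars \<phi> M\<^esub>"
      by (intro bexI[of _ "\<ominus>\<^bsub>M\<^esub> x"]) (simp_all add: restrict_scalars_def M.M.l_neg)
  qed (simp_all add: restrict_scalars_def M.M.a_ac)
  then show ?thesis
    using assms(2)
    by (intro moduleI R.is_cring)
      (simp_all add: restrict_scalars_def ring_hom_closed ring_hom_add ring_hom_mult ring_hom_one
        M.smult_l_distr M.smult_r_distr M.smult_assoc1)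
qed

section \<open>Bilinear maps and the tensor product\<close>

definition bilinear_map ::
  "('r, 'e) ring_scheme \<Rightarrow> ('r, 'm, 'f) module_scheme \<Rightarrow> ('r, 'n, 'g) module_scheme \<Rightarrow>
    ('r, 'q, 'h) module_scheme \<Rightarrow> ('m \<Rightarrow> 'n \<Rightarrow> 'q) \<Rightarrow> bool"
  where "bilinear_map R M N P \<beta> \<longleftrightarrow>
    (\<forall>x\<in>carrier M. \<forall>y\<in>carrier N. \<beta> x y \<in> carrier P) \<and>
    (\<forall>x\<in>carrier M. \<forall>x'\<in>carrier M. \<forall>y\<in>carrier N. \<beta> (x \<oplus>\<^bsub>M\<^esub> x') y = \<beta> x y \<oplus>\<^bsub>P\<^esub> \<beta> x' y) \<and>
    (\<forall>x\<in>carrier M. \<forall>y\<in>carrier N. \<forall>y'\<in>carrier N. \<beta> x (y \<oplus>\<^bsub>N\<^esub> y') = \<beta> x y \<oplus>\<^bsub>P\<^esub> \<beta> x y') \<and>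
    (\<forall>r\<in>carrier R. \<forall>x\<in>carrier M. \<forall>y\<in>carrier N. \<beta> (r \<odot>\<^bsub>M\<^esub> x) y = r \<odot>\<^bsub>P\<^esub> \<beta> x y) \<and>
    (\<forall>r\<in>carrier R. \<forall>x\<in>carrier M. \<forall>y\<in>carrier N. \<beta> x (r \<odot>\<^bsub>N\<^esub> y) = r \<odot>\<^bsub>P\<^esub> \<beta> x y)"

context
  fixes R :: "('r, 'e) ring_scheme" and M :: "('r, 'm, 'f) module_scheme"
    and N :: "('r, 'n, 'g) module_scheme"
  assumes M: "module R M" and N: "module R N"
begin

interpretation M: module R M by (rule M)
interpretation N: module R N by (rule N)

private abbreviation "F \<equiv> free_module R (carrier M \<times> carrier N)"
private abbreviation "K \<equiv> tensor_kernel R M N"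
private abbreviation "e \<equiv> basis_elt R"

interpretation F: module R F by (rule M.R.module_free_module)

lemma tensor_basis_elt_closed:
  "x \<in> carrier M \<Longrightarrow> y \<in> carrier N \<Longrightarrow> e (x, y) \<in> carrier F"
  by (rule M.R.basis_elt_closed) simp

lemma tensor_relations_closed: "tensor_relations R M N \<subseteq> carrier F"
  unfolding tensor_relations_def Let_def
  by (intro subsetI; elim UnE CollectE exE conjE) (simp_all add: tensor_basis_elt_closed)

lemma submodule_tensor_kernel: "submodule K R F"
  unfolding tensor_kernel_def by (rule F.submodule_submodule_gen[OF tensor_relations_closed])

lemma tensor_kernel_smult_left:
  assumes "r \<in> carrier R" and "x \<in> carrier M" and "y \<in> carrier N"
  shows "e (r \<odot>\<^bsub>M\<^esub> x, y) \<ominus>\<^bsub>F\<^esub> r \<odot>\<^bsub>F\<^esub> e (x, y) \<in> K"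
proof -
  have "e (r \<odot>\<^bsub>M\<^esub> x, y) \<ominus>\<^bsub>F\<^esub> r \<odot>\<^bsub>F\<^esub> e (x, y) \<in> tensor_relations R M N"
    unfolding tensor_relations_def Let_def using assms by blast
  then show ?thesis
    unfolding tensor_kernel_def by (rule subsetD[OF submodule_gen_superset])
qed

lemma tensor_kernel_smult_right:
  assumes "r \<in> carrier R" and "x \<in> carrier M" and "y \<in> carrier N"
  shows "e (x, r \<odot>\<^bsub>N\<^esub> y) \<ominus>\<^bsub>F\<^esub> r \<odot>\<^bsub>F\<^esub> e (x, y) \<in> K"
proof -
  have "e (x, r \<odot>\<^bsub>N\<^esub> y) \<ominus>\<^bsub>F\<^esub> r \<odot>\<^bsub>F\<^esub> e (x, y) \<in> tensor_relations R M N"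
    unfolding tensor_relations_def Let_def using assms by blast
  then show ?thesis
    unfolding tensor_kernel_def by (rule subsetD[OF submodule_gen_superset])
qed

lemma pure_tensor_closed:
  "x \<in> carrier M \<Longrightarrow> y \<in> carrier N \<Longrightarrow> pure_tensor R M N x y \<in> carrier (tensor_module R M N)"
  by (simp add: pure_tensor_def tensor_module_def F.quot_module_carrier tensor_basis_elt_closed)

lemma pure_tensor_smult_swap:
  assumes "r \<in> carrier R" and "x \<in> carrier M" and "y \<in> carrier N"
  shows "pure_tensor R M N x (r \<odot>\<^bsub>N\<^esub> y) = pure_tensor R M N (r \<odot>\<^bsub>M\<^esub> x) y"
proof -
  let ?z = "r \<odot>\<^bsub>F\<^esub> e (x, y)"
  have cl: "e (x, r \<odot>\<^bsub>N\<^esub> y) \<in> carrier F" "e (r \<odot>\<^bsub>M\<^esub> x, y) \<in> carrier F" "?z \<in> carrier F"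
    using assms by (simp_all add: tensor_basis_elt_closed)
  have "K +>\<^bsub>F\<^esub> e (x, r \<odot>\<^bsub>N\<^esub> y) = K +>\<^bsub>F\<^esub> ?z"
    using tensor_kernel_smult_right[OF assms]
    by (rule F.coset_eq_iff[OF submodule_tensor_kernel cl(1,3), THEN iffD2])
  also have "\<dots> = K +>\<^bsub>F\<^esub> e (r \<odot>\<^bsub>M\<^esub> x, y)"
    using tensor_kernel_smult_left[OF assms]
    by (rule F.coset_eq_iff[OF submodule_tensor_kernel cl(2,3), THEN iffD2, symmetric])
  finally show ?thesis
    unfolding pure_tensor_def .
qed

lemma pure_tensor_zero_left:
  assumes y: "y \<in> carrier N"
  shows "pure_tensor R M N \<zero>\<^bsub>M\<^esub> y = \<zero>\<^bsub>tensor_module R M N\<^esub>"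
proof -
  interpret K: abelian_subgroup K F
    by (rule F.abelian_subgroup_submodule[OF submodule_tensor_kernel])
  have cl: "e (\<zero>\<^bsub>M\<^esub>, y) \<in> carrier F"
    using y by (simp add: tensor_basis_elt_closed)
  \<comment> \<open>The zero of \<open>M\<close> is read as 0 times itself, so that the relation for
    scalars in the left factor applies.\<close>
  have "pure_tensor R M N \<zero>\<^bsub>M\<^esub> y = K +>\<^bsub>F\<^esub> (\<zero>\<^bsub>R\<^esub> \<odot>\<^bsub>F\<^esub> e (\<zero>\<^bsub>M\<^esub>, y))"
    unfolding pure_tensor_def using tensor_kernel_smult_left[of "\<zero>\<^bsub>R\<^esub>" "\<zero>\<^bsub>M\<^esub>" y] y cl
    by (subst F.coset_eq_iff[OF submodule_tensor_kernel]) simp_all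
  also have "\<dots> = K"
    using cl K.a_rcos_const[OF K.zero_closed] by simp
  finally show ?thesis
    by (simp add: tensor_module_def quot_module_def)
qed

text \<open>A bilinear map extends linearly to the free module on pairs, kills the tensor relations
  and so factors through the tensor product. It can therefore be used to read information out of a
  vanishing pure tensor.\<close>

lemma bilinear_map_zero_if_pure_tensor_zero:
  assumes P: "module R P" and \<beta>: "bilinear_map R M N P \<beta>"
    and x: "x \<in> carrier M" and y: "y \<in> carrier N"
    and zero: "pure_tensor R M N x y = \<zero>\<^bsub>tensor_module R M N\<^esub>"
  shows "\<beta> x y = \<zero>\<^bsub>P\<^esub>"
proof -
  interpret P: module R P by fact
  let ?L = "restrict (linear_ext R P (case_prod \<beta>)) (carrier F)"
  have L: "?L \<in> module_homs R F P"
    using \<beta> by (intro P.linear_ext_hom) (auto simp: bilinear_map_def)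
  have Le: "?L (e (a, b)) = \<beta> a b" if "a \<in> carrier M" "b \<in> carrier N" for a b
    using that \<beta> P.linear_ext_basis_elt[of "(a, b)" "carrier M \<times> carrier N" "case_prod \<beta>"]
    by (simp add: tensor_basis_elt_closed bilinear_map_def)
  note L_simps = module_homs_minus[OF F.abelian_group_axioms P.abelian_group_axioms L]
    module_homs_add[OF L] module_homs_smult[OF L] Le tensor_basis_elt_closed
  have "?L f = \<zero>\<^bsub>P\<^esub>" if "f \<in> tensor_relations R M N" for f
    using that \<beta> unfolding tensor_relations_def Let_def bilinear_map_def
    by (elim UnE CollectE exE conjE)
      (simp_all add: L_simps P.minus_eq P.r_neg del: restrict_apply)
  then obtain h where h: "h \<in> module_homs R (tensor_module R M N) P"
    "\<And>f. f \<in> carrier F \<Longrightarrow> h (K +>\<^bsub>F\<^esub> f) = ?L f"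
    using F.ex_module_homs_quot[OF P L tensor_relations_closed]
    unfolding tensor_module_def tensor_kernel_def by blast
  interpret K: abelian_subgroup K F
    by (rule F.abelian_subgroup_submodule[OF submodule_tensor_kernel])
  have "\<beta> x y = h (pure_tensor R M N x y)"
    using h(2)[OF tensor_basis_elt_closed[OF x y]] x y by (simp only: Le pure_tensor_def)
  also have "pure_tensor R M N x y = K +>\<^bsub>F\<^esub> \<zero>\<^bsub>F\<^esub>"
    using zero by (simp add: tensor_module_def quot_module_def K.a_rcos_const)
  also have "h \<dots> = \<zero>\<^bsub>P\<^esub>"
    using h(2)[OF F.zero_closed] module_homs_zero[OF F.abelian_group_axioms P.abelian_group_axioms L]
    by simp
  finally show ?thesis .
qed

lemma abelian_group_tensor_module: "abelian_group (tensor_module R M N)"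
  unfolding tensor_module_def by (rule F.abelian_group_quot_module[OF submodule_tensor_kernel])

end

text \<open>If \<open>f : N \<rightarrow> N'\<close> is injective, \<open>f y = r z\<close> and \<open>r x = 0\<close>, then \<open>x \<otimes> y\<close> is mapped
  to \<open>x \<otimes> r z = r x \<otimes> z = 0\<close>, so that \<open>x \<otimes> y = 0\<close> by flatness.\<close>

lemma flat_module_bilinear_map_zero:
  fixes R :: "('r, 'e) ring_scheme" and N N' :: "('r, 'r) module"
  assumes flat: "flat_module R M" and N: "module R N" and N': "module R N'" and P: "module R P"
    and f: "f \<in> module_homs R N N'" "inj_on f (carrier N)"
    and \<beta>: "bilinear_map R M N P \<beta>"
    and r: "r \<in> carrier R" and x: "x \<in> carrier M" and y: "y \<in> carrier N" and z: "z \<in> carrier N'"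
    and fy: "f y = r \<odot>\<^bsub>N'\<^esub> z" and rx: "r \<odot>\<^bsub>M\<^esub> x = \<zero>\<^bsub>M\<^esub>"
  shows "\<beta> x y = \<zero>\<^bsub>P\<^esub>"
proof -
  have M: "module R M"
    using flat by (simp add: flat_module_def)
  obtain g where g: "g \<in> module_homs R (tensor_module R M N) (tensor_module R M N')"
    "\<And>x y. x \<in> carrier M \<Longrightarrow> y \<in> carrier N \<Longrightarrow> g (pure_tensor R M N x y) = pure_tensor R M N' x (f y)"
    "inj_on g (carrier (tensor_module R M N))"
    using flat N N' f unfolding flat_module_def by meson
  interpret T: abelian_group "tensor_module R M N"
    by (rule abelian_group_tensor_module[OF M N])
  have "g (pure_tensor R M N x y) = pure_tensor R M N' (r \<odot>\<^bsub>M\<^esub> x) z"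
    unfolding g(2)[OF x y] fy by (rule pure_tensor_smult_swap[OF M N' r x z])
  also have "\<dots> = \<zero>\<^bsub>tensor_module R M N'\<^esub>"
    unfolding rx by (rule pure_tensor_zero_left[OF M N' z])
  also have "\<dots> = g \<zero>\<^bsub>tensor_module R M N\<^esub>"
    by (rule module_homs_zero[OF T.abelian_group_axioms abelian_group_tensor_module[OF M N'] g(1), symmetric])
  finally have "pure_tensor R M N x y = \<zero>\<^bsub>tensor_module R M N\<^esub>"
    using inj_onD[OF g(3)] pure_tensor_closed[OF M N x y] by blast
  then show ?thesis
    by (rule bilinear_map_zero_if_pure_tensor_zero[OF M N P \<beta> x y])
qed

section \<open>The reduction of a flat algebra over the Witt vectors\<close>

locale witt_algebra = witt_field k p
  for k :: "('k, 'e) ring_scheme" (structure) and p :: nat +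
  fixes A :: "('k \<times> 'k, 'a) module"
  assumes algebra_A: "algebra (W2 p k) A" and algebra_reduction: "algebra k (reduction p k A)"
    and flat_A: "flat_module (W2 p k) A"
begin

abbreviation "A0 \<equiv> reduction p k A"
abbreviation "\<pi> \<equiv> red p A"

sublocale A: cring A
  using algebra_A by (rule algebra.axioms(2))

sublocale AW: module W A
  using algebra_A by (rule algebra.axioms(1))

sublocale A0: cring A0
  using algebra_reduction by (rule algebra.axioms(2))

sublocale A0k: module k A0
  using algebra_reduction by (rule algebra.axioms(1))

lemma p_elt_closed [simp]: "p_elt p A \<in> carrier A"
  by (simp add: p_elt_def)

sublocale I: ideal "PIdl\<^bsub>A\<^esub> (p_elt p A)" A
  by (rule A.cgenideal_ideal) simp

lemma ring_hom_red: "\<pi> \<in> ring_hom A A0"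
  using I.rcos_ring_hom
  by (simp add: ring_hom_def reduction_def Let_def red_def Pi_def)

lemma red_simps [simp]:
  "x \<in> carrier A \<Longrightarrow> \<pi> x \<in> carrier A0"
  "\<pi> \<one>\<^bsub>A\<^esub> = \<one>\<^bsub>A0\<^esub>"
  "x \<in> carrier A \<Longrightarrow> y \<in> carrier A \<Longrightarrow> \<pi> (x \<oplus>\<^bsub>A\<^esub> y) = \<pi> x \<oplus>\<^bsub>A0\<^esub> \<pi> y"
  "x \<in> carrier A \<Longrightarrow> y \<in> carrier A \<Longrightarrow> \<pi> (x \<otimes>\<^bsub>A\<^esub> y) = \<pi> x \<otimes>\<^bsub>A0\<^esub> \<pi> y"
  using ring_hom_red by (auto simp: ring_hom_def Pi_def)

sublocale red: ring_hom_cring A A0 \<pi>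
  by unfold_locales (rule ring_hom_red)

lemma red_surj:
  assumes "y \<in> carrier A0"
  obtains x where "x \<in> carrier A" and "y = \<pi> x"
  using assms by (auto simp: reduction_def Let_def FactRing_def A_RCOSETS_def' a_r_coset_def' red_def)

lemma p_ideal: "PIdl\<^bsub>A\<^esub> (p_elt p A) = {[p] \<cdot>\<^bsub>A\<^esub> x |x. x \<in> carrier A}"
  unfolding cgenideal_def p_elt_def
  by (intro Collect_cong ex_cong1) (auto simp: A.add_pow_rdistr)

lemma red_eq_iff:
  assumes "x \<in> carrier A" and "y \<in> carrier A"
  shows "\<pi> x = \<pi> y \<longleftrightarrow> (\<exists>z\<in>carrier A. x = y \<oplus>\<^bsub>A\<^esub> [p] \<cdot>\<^bsub>A\<^esub> z)"
proof -
  have "\<pi> x = \<pi> y \<longleftrightarrow> x \<in> PIdl\<^bsub>A\<^esub> (p_elt p A) +>\<^bsub>A\<^esub> y"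
    unfolding red_def using assms I.a_repr_independence' I.a_repr_independenceD by blast
  also have "\<dots> \<longleftrightarrow> (\<exists>z\<in>carrier A. x = y \<oplus>\<^bsub>A\<^esub> [p] \<cdot>\<^bsub>A\<^esub> z)"
    unfolding p_ideal a_r_coset_def' using assms A.a_comm[of y] by auto
  finally show ?thesis .
qed

lemma nat_smult: "x \<in> carrier A \<Longrightarrow> ([n] \<cdot>\<^bsub>W\<^esub> \<one>\<^bsub>W\<^esub>) \<odot>\<^bsub>A\<^esub> x = [(n::nat)] \<cdot>\<^bsub>A\<^esub> x"
  by (induction n) (simp_all add: AW.smult_l_distr del: W2_simps)

lemma p_smult: "x \<in> carrier A \<Longrightarrow> (\<zero>, \<one>) \<odot>\<^bsub>A\<^esub> x = [p] \<cdot>\<^bsub>A\<^esub> x"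
  using nat_smult[of x p] by (simp only: W2_p_one)

lemma p_elt_eq: "p_elt p A = (\<zero>, \<one>) \<odot>\<^bsub>A\<^esub> \<one>\<^bsub>A\<^esub>"
  by (simp add: p_elt_def p_smult)

text \<open>The square of p vanishes already in W_2(k), where (0, 1) times (0, 1) is (0, 0).\<close>

lemma p_p_smult [simp]:
  assumes "x \<in> carrier A"
  shows "[p] \<cdot>\<^bsub>A\<^esub> ([p] \<cdot>\<^bsub>A\<^esub> x) = \<zero>\<^bsub>A\<^esub>"
proof -
  have "[p] \<cdot>\<^bsub>A\<^esub> ([p] \<cdot>\<^bsub>A\<^esub> x) = ((\<zero>, \<one>) \<otimes>\<^bsub>W\<^esub> (\<zero>, \<one>)) \<odot>\<^bsub>A\<^esub> x"
    using assms by (subst AW.smult_assoc1) (simp_all add: p_smult del: W2_simps(5))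
  also have "(\<zero>, \<one>) \<otimes>\<^bsub>W\<^esub> (\<zero>, \<one>) = \<zero>\<^bsub>W\<^esub>"
    using p_gt_0 by (simp add: nat_pow_zero)
  finally show ?thesis
    using assms by (simp only: AW.smult_l_null)
qed

text \<open>Two lifts of the same class differ by some p z, and p (p z) = 0, so the definite
  description in \<open>times_p\<close> is well defined.\<close>

lemma times_p_red:
  assumes x: "x \<in> carrier A"
  shows "times_p p A (\<pi> x) = [p] \<cdot>\<^bsub>A\<^esub> x"
  unfolding times_p_def
proof (rule the_equality)
  show "\<forall>y\<in>carrier A. \<pi> y = \<pi> x \<longrightarrow> [p] \<cdot>\<^bsub>A\<^esub> y = [p] \<cdot>\<^bsub>A\<^esub> x"
  proof (intro ballI impI)
    fix y assume y: "y \<in> carrier A" and "\<pi> y = \<pi> x"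
    then obtain z where z: "z \<in> carrier A" "y = x \<oplus>\<^bsub>A\<^esub> [p] \<cdot>\<^bsub>A\<^esub> z"
      using red_eq_iff x by blast
    then show "[p] \<cdot>\<^bsub>A\<^esub> y = [p] \<cdot>\<^bsub>A\<^esub> x"
      using x by (simp add: A.add.pow_mult_distrib A.a_comm)
  qed
qed (use x in blast)

text \<open>Scalar multiplication on \<open>reduction\<close> is a union over all lifts of the
  scalar and could exceed a single coset. As A_0 is a k-module, the result lies in its carrier and
  is one coset, and it contains r x. This is how the k-algebra hypothesis ties the action of k on
  A_0 to that of W_2(k) on A.\<close>

lemma smult_red:
  assumes r: "r \<in> carrier W" and x: "x \<in> carrier A"
  shows "fst r \<odot>\<^bsub>A0\<^esub> \<pi> x = \<pi> (r \<odot>\<^bsub>A\<^esub> x)"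
proof -
  have rx: "r \<odot>\<^bsub>A\<^esub> x \<in> carrier A"
    using r x by (rule AW.smult_closed)
  have "fst r \<in> carrier k"
    using r by auto
  then obtain y where y: "y \<in> carrier A" "fst r \<odot>\<^bsub>A0\<^esub> \<pi> x = \<pi> y"
    using A0k.smult_closed red_simps(1)[OF x] red_surj by metis
  have "x \<in> \<pi> x"
    unfolding red_def using x by (rule I.a_rcos_self)
  then have "\<pi> (r \<odot>\<^bsub>A\<^esub> x) \<subseteq> fst r \<odot>\<^bsub>A0\<^esub> \<pi> x"
    unfolding reduction_def Let_def using r by auto
  moreover have "r \<odot>\<^bsub>A\<^esub> x \<in> \<pi> (r \<odot>\<^bsub>A\<^esub> x)"
    unfolding red_def using rx by (rule I.a_rcos_self)
  ultimately have "r \<odot>\<^bsub>A\<^esub> x \<in> \<pi> y"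
    unfolding y(2) by blast
  then have "\<pi> y = \<pi> (r \<odot>\<^bsub>A\<^esub> x)"
    unfolding red_def using y(1) by (intro I.a_repr_independence')
  then show ?thesis
    using y(2) by simp
qed

lemma red_eq_zero_if_p_torsion:
  assumes x: "x \<in> carrier A" and px: "[p] \<cdot>\<^bsub>A\<^esub> x = \<zero>\<^bsub>A\<^esub>"
  shows "\<pi> x = \<zero>\<^bsub>A0\<^esub>"
proof -
  \<comment> \<open>\<open>N\<close> is \<open>k\<close>, copied onto the element type of \<open>W\<close>; \<open>f\<close> is multiplication by \<open>p\<close> on \<open>W\<close>, factored
    through \<open>k\<close>.\<close>
  define N :: "('k \<times> 'k, 'k \<times> 'k) module" where "N =
    \<lparr>carrier = carrier k \<times> {\<zero>}, monoid.mult = undefined, one = undefined, zero = (\<zero>, \<zero>),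
     add = (\<lambda>x y. (fst x \<oplus> fst y, \<zero>)), smult = (\<lambda>r x. (fst r \<otimes> fst x, \<zero>))\<rparr>"
  define f where "f = (\<lambda>x\<in>carrier N. (\<zero>, fst x [^] p))"
  let ?P = "restrict_scalars (fst :: 'k \<times> 'k \<Rightarrow> 'k) A0"
  let ?\<beta> = "\<lambda>a (c :: 'k \<times> 'k). fst c \<odot>\<^bsub>A0\<^esub> \<pi> a"
  have "abelian_group N"
  proof (rule abelian_groupI)
    fix x assume "x \<in> carrier N"
    then show "\<exists>y\<in>carrier N. y \<oplus>\<^bsub>N\<^esub> x = \<zero>\<^bsub>N\<^esub>"
      by (intro bexI[of _ "(\<ominus> fst x, \<zero>)"]) (auto simp: N_def l_neg)
  qed (auto simp: N_def a_ac)
  then have N: "module W N"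
    by (intro moduleI W.is_cring) (auto simp: N_def l_distr r_distr m_assoc)
  have "(fst :: 'k \<times> 'k \<Rightarrow> 'k) \<in> ring_hom W k"
    by (auto simp: ring_hom_def)
  then have P: "module W ?P"
    by (rule module_restrict_scalars[OF W.is_cring _ algebra.axioms(1)[OF algebra_reduction]])
  have f: "f \<in> module_homs W N (self_module W)"
    using p_gt_0 by (auto simp: module_homs_def f_def N_def self_module_def frob_add nat_pow_distrib nat_pow_zero)
  have inj: "inj_on f (carrier N)"
    by (rule inj_onI) (auto simp: f_def N_def dest: frob_inj)
  \<comment> \<open>Linearity in the first argument is \<open>smult_red\<close>: the class of r a is
    the residue of r times the class of a.\<close>
  have \<beta>: "bilinear_map W A N ?P ?\<beta>"
    unfolding bilinear_map_def
    by (auto simp: restrict_scalars_def N_def A0k.smult_r_distr A0k.smult_l_distr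
        smult_red[symmetric] A0k.smult_assoc1[symmetric] m_comm)
  \<comment> \<open>The copy of 1 in \<open>N\<close> is sent to p times the unit of W_2(k). These
    are the \<open>y\<close>, \<open>r\<close> and \<open>z\<close> of
    \<open>flat_module_bilinear_map_zero\<close>.\<close>
  have fy: "f (\<one>, \<zero>) = (\<zero>, \<one>) \<odot>\<^bsub>self_module W\<^esub> \<one>\<^bsub>W\<^esub>"
    using p_gt_0 by (simp add: f_def N_def self_module_def nat_pow_zero)
  have "(\<one>, \<zero>) \<in> carrier N" "\<one>\<^bsub>W\<^esub> \<in> carrier (self_module W)" "(\<zero>, \<one>) \<in> carrier W"
    "(\<zero>, \<one>) \<odot>\<^bsub>A\<^esub> x = \<zero>\<^bsub>A\<^esub>"
    using x px by (simp_all add: N_def self_module_def p_smult)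
  then have "?\<beta> x (\<one>, \<zero>) = \<zero>\<^bsub>?P\<^esub>"
    using flat_module_bilinear_map_zero[OF flat_A N module_self_module[OF W.is_cring] P f inj \<beta> _ x _ _ fy]
    by blast
  then show ?thesis
    using x by (simp add: restrict_scalars_def)
qed

section \<open>The injection of A_0 into A induced by multiplication by p\<close>

lemma times_p_closed [simp]: "y \<in> carrier A0 \<Longrightarrow> times_p p A y \<in> carrier A"
  by (elim red_surj) (simp add: times_p_red)

lemma times_p_add:
  "y \<in> carrier A0 \<Longrightarrow> z \<in> carrier A0 \<Longrightarrow> times_p p A (y \<oplus>\<^bsub>A0\<^esub> z) = times_p p A y \<oplus>\<^bsub>A\<^esub> times_p p A z"
  by (elim red_surj) (simp add: times_p_red red_simps(3)[symmetric] A.add.pow_mult_distrib A.a_comm del: red_simps(3) red.hom_add)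

lemma times_p_mult:
  "a \<in> carrier A \<Longrightarrow> y \<in> carrier A0 \<Longrightarrow> times_p p A (\<pi> a \<otimes>\<^bsub>A0\<^esub> y) = a \<otimes>\<^bsub>A\<^esub> times_p p A y"
  by (elim red_surj) (simp add: times_p_red red_simps(4)[symmetric] A.add_pow_rdistr del: red_simps(4) red.hom_mult)

lemma times_p_mult_times_p:
  "y \<in> carrier A0 \<Longrightarrow> z \<in> carrier A0 \<Longrightarrow> times_p p A y \<otimes>\<^bsub>A\<^esub> times_p p A z = \<zero>\<^bsub>A\<^esub>"
  by (elim red_surj) (simp add: times_p_red A.add_pow_rdistr A.add_pow_ldistr)

lemma times_p_inj:
  assumes y: "y \<in> carrier A0" and z: "z \<in> carrier A0"
  shows "times_p p A y = times_p p A z \<longleftrightarrow> y = z"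
proof
  assume eq: "times_p p A y = times_p p A z"
  obtain a b where ab: "a \<in> carrier A" "y = \<pi> a" "b \<in> carrier A" "z = \<pi> b"
    using y z red_surj by metis
  have "[p] \<cdot>\<^bsub>A\<^esub> (a \<ominus>\<^bsub>A\<^esub> b) = [p] \<cdot>\<^bsub>A\<^esub> a \<ominus>\<^bsub>A\<^esub> [p] \<cdot>\<^bsub>A\<^esub> b"
    using ab by (simp add: A.minus_eq A.add.pow_mult_distrib A.a_comm A.add.nat_pow_inv)
  also have "\<dots> = \<zero>\<^bsub>A\<^esub>"
    using eq ab by (simp add: times_p_red)
  finally have "\<pi> (a \<ominus>\<^bsub>A\<^esub> b) = \<zero>\<^bsub>A0\<^esub>"
    using ab by (intro red_eq_zero_if_p_torsion) simp_all
  then have "\<pi> a \<ominus>\<^bsub>A0\<^esub> \<pi> b = \<zero>\<^bsub>A0\<^esub>"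
    using ab by (simp add: A.minus_eq A0.minus_eq)
  then show "y = z"
    using ab by simp
qed simp

lemma red_p_smult: "x \<in> carrier A \<Longrightarrow> \<pi> ([p] \<cdot>\<^bsub>A\<^esub> x) = \<zero>\<^bsub>A0\<^esub>"
  using red_eq_iff[of "[p] \<cdot>\<^bsub>A\<^esub> x" "\<zero>\<^bsub>A\<^esub>"] by auto

lemma red_times_p [simp]: "y \<in> carrier A0 \<Longrightarrow> \<pi> (times_p p A y) = \<zero>\<^bsub>A0\<^esub>"
  by (elim red_surj) (simp add: times_p_red red_p_smult)

lemma smult_one_power:
  "r \<in> carrier W \<Longrightarrow> (r \<odot>\<^bsub>A\<^esub> \<one>\<^bsub>A\<^esub>) [^]\<^bsub>A\<^esub> (n::nat) = (r [^]\<^bsub>W\<^esub> n) \<odot>\<^bsub>A\<^esub> \<one>\<^bsub>A\<^esub>"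
proof (induction n)
  case 0
  then show ?case by (simp del: W2_simps)
next
  case (Suc n)
  then show ?case
    using algebra.smult_assoc2[OF algebra_A]
    by (simp add: AW.smult_assoc1 W.nat_pow_closed del: W2_simps)
qed

text \<open>This is the image in A of the identity phi(r) = r^p + p (b, 0) in W_2(k), with b the
  second coordinate of r. On scalars phi thus already has the shape of the p-th power plus p times a
  class.\<close>

lemma W2_frob_smult_one:
  assumes r: "r \<in> carrier W"
  shows "W2_frob p k r \<odot>\<^bsub>A\<^esub> \<one>\<^bsub>A\<^esub> =
    (r \<odot>\<^bsub>A\<^esub> \<one>\<^bsub>A\<^esub>) [^]\<^bsub>A\<^esub> p \<oplus>\<^bsub>A\<^esub> times_p p A (snd r \<odot>\<^bsub>A0\<^esub> \<one>\<^bsub>A0\<^esub>)"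
proof -
  have s: "(snd r, \<zero>) \<in> carrier W" and p: "(\<zero>, \<one>) \<in> carrier W"
    using r by auto
  \<comment> \<open>The summands are commuted to bring the vector with first coordinate 0 to the
    left, where the carry vanishes.\<close>
  have "W2_frob p k r = r [^]\<^bsub>W\<^esub> p \<oplus>\<^bsub>W\<^esub> (\<zero>, \<one>) \<otimes>\<^bsub>W\<^esub> (snd r, \<zero>)"
    using W.a_comm[OF W.m_closed[OF p s] W.nat_pow_closed[OF r, of p]] r p_gt_0
    by (auto simp: W2_power_p W2_frob_def nat_pow_zero)
  then have "W2_frob p k r \<odot>\<^bsub>A\<^esub> \<one>\<^bsub>A\<^esub> =
      (r \<odot>\<^bsub>A\<^esub> \<one>\<^bsub>A\<^esub>) [^]\<^bsub>A\<^esub> p \<oplus>\<^bsub>A\<^esub> (\<zero>, \<one>) \<odot>\<^bsub>A\<^esub> ((snd r, \<zero>) \<odot>\<^bsub>A\<^esub> \<one>\<^bsub>A\<^esub>)"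
    using r s p
    by (simp only: AW.smult_l_distr AW.smult_assoc1 W.nat_pow_closed W.m_closed A.one_closed smult_one_power)
  also have "(\<zero>, \<one>) \<odot>\<^bsub>A\<^esub> ((snd r, \<zero>) \<odot>\<^bsub>A\<^esub> \<one>\<^bsub>A\<^esub>) = times_p p A (\<pi> ((snd r, \<zero>) \<odot>\<^bsub>A\<^esub> \<one>\<^bsub>A\<^esub>))"
    using AW.smult_closed[OF s A.one_closed] by (simp add: p_smult times_p_red)
  also have "\<pi> ((snd r, \<zero>) \<odot>\<^bsub>A\<^esub> \<one>\<^bsub>A\<^esub>) = snd r \<odot>\<^bsub>A0\<^esub> \<one>\<^bsub>A0\<^esub>"
    using smult_red[OF s A.one_closed] by simp
  finally show ?thesis .
qed

end

section \<open>Total \<open>p\<close>-differentials and lifts of Frobenius\<close>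

lemma setcompr_eq_image2: "{g a b |a b. a \<in> S \<and> b \<in> T} = (\<lambda>(a, b). g a b) ` (S \<times> T)"
  by auto

text \<open>\<open>c\<close> stands for the value at \<open>p\<close>, and \<open>snd r\<close> is \<open>(\<phi>(r) - r^p) / p\<close>.\<close>

definition tot_derivation ::
  "nat \<Rightarrow> ('k, 'e) ring_scheme \<Rightarrow> ('k \<times> 'k, 'a, 'f) module_scheme \<Rightarrow> 'a set \<Rightarrow> ('a \<Rightarrow> 'a set) \<Rightarrow> bool"
  where "tot_derivation p k A c \<delta> \<longleftrightarrow>
    (let A0 = reduction p k A in
     (\<forall>a\<in>carrier A. \<forall>b\<in>carrier A.
        \<delta> (a \<oplus>\<^bsub>A\<^esub> b) = \<delta> a \<oplus>\<^bsub>A0\<^esub> \<delta> b \<oplus>\<^bsub>A0\<^esub> red p A (Cp p A a b) \<otimes>\<^bsub>A0\<^esub> c) \<and>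
     (\<forall>a\<in>carrier A. \<forall>b\<in>carrier A.
        \<delta> (a \<otimes>\<^bsub>A\<^esub> b) =
          red p A (b [^]\<^bsub>A\<^esub> p) \<otimes>\<^bsub>A0\<^esub> \<delta> a \<oplus>\<^bsub>A0\<^esub> red p A (a [^]\<^bsub>A\<^esub> p) \<otimes>\<^bsub>A0\<^esub> \<delta> b) \<and>
     (\<forall>r\<in>carrier (W2 p k). \<delta> (r \<odot>\<^bsub>A\<^esub> \<one>\<^bsub>A\<^esub>) = (snd r \<odot>\<^bsub>A0\<^esub> \<one>\<^bsub>A0\<^esub>) \<otimes>\<^bsub>A0\<^esub> c))"

context witt_algebra
begin

section \<open>Universal property of the total p-differentials\<close>

abbreviation "S0 \<equiv> self_module A0"
abbreviation "F \<equiv> free_module A0 (carrier A)"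
abbreviation "e \<equiv> basis_elt A0"

sublocale F: module A0 F
  by (rule A0.module_free_module)

lemma module_S0: "module A0 S0"
  by (rule module_self_module) (rule A0.is_cring)

sublocale S0: module A0 S0
  by (rule module_S0)

lemma S0_simps [simp]:
  "carrier S0 = carrier A0" "\<zero>\<^bsub>S0\<^esub> = \<zero>\<^bsub>A0\<^esub>" "x \<oplus>\<^bsub>S0\<^esub> y = x \<oplus>\<^bsub>A0\<^esub> y" "x \<odot>\<^bsub>S0\<^esub> y = x \<otimes>\<^bsub>A0\<^esub> y"
  by (simp_all add: self_module_def)

lemma smult_one_closed: "r \<in> carrier W \<Longrightarrow> r \<odot>\<^bsub>A\<^esub> \<one>\<^bsub>A\<^esub> \<in> carrier A"
  by (rule AW.smult_closed) simp_all

lemma snd_smult_one_closed: "r \<in> carrier W \<Longrightarrow> snd r \<odot>\<^bsub>A0\<^esub> \<one>\<^bsub>A0\<^esub> \<in> carrier A0"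
  by (rule A0k.smult_closed) auto

text \<open>Written as images, the relations turn a statement about all of them into bounded
  quantifiers over the carriers, which is the form of \<open>tot_derivation\<close>.\<close>

lemma tot_relations_eq:
  "tot_relations p k A =
    (\<lambda>(a, b). e (a \<oplus>\<^bsub>A\<^esub> b) \<ominus>\<^bsub>F\<^esub> (e a \<oplus>\<^bsub>F\<^esub> e b \<oplus>\<^bsub>F\<^esub> \<pi> (Cp p A a b) \<odot>\<^bsub>F\<^esub> e (p_elt p A)))
      ` (carrier A \<times> carrier A) \<union>
    (\<lambda>(a, b). e (a \<otimes>\<^bsub>A\<^esub> b) \<ominus>\<^bsub>F\<^esub> (\<pi> (b [^]\<^bsub>A\<^esub> p) \<odot>\<^bsub>F\<^esub> e a \<oplus>\<^bsub>F\<^esub> \<pi> (a [^]\<^bsub>A\<^esub> p) \<odot>\<^bsub>F\<^esub> e b))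
      ` (carrier A \<times> carrier A) \<union>
    (\<lambda>r. e (r \<odot>\<^bsub>A\<^esub> \<one>\<^bsub>A\<^esub>) \<ominus>\<^bsub>F\<^esub> (snd r \<odot>\<^bsub>A0\<^esub> \<one>\<^bsub>A0\<^esub>) \<odot>\<^bsub>F\<^esub> e (p_elt p A)) ` carrier W"
  (is "_ = ?X \<union> ?Y \<union> ?Z")
proof -
  have "?Z = (\<lambda>r. e (r \<odot>\<^bsub>A\<^esub> \<one>\<^bsub>A\<^esub>) \<ominus>\<^bsub>F\<^esub> (frob_quotient p k r \<odot>\<^bsub>A0\<^esub> \<one>\<^bsub>A0\<^esub>) \<odot>\<^bsub>F\<^esub> e (p_elt p A)) ` carrier W"
    by (intro image_cong refl) (simp only: frob_quotient_eq)
  then show ?thesis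
    unfolding tot_relations_def Let_def by (simp only: setcompr_eq_image2 Setcompr_eq_image)
qed

lemma e_closed: "x \<in> carrier A \<Longrightarrow> e x \<in> carrier F"
  by (rule A0.basis_elt_closed)

lemma tot_relations_closed: "tot_relations p k A \<subseteq> carrier F"
  unfolding tot_relations_eq
  by (intro Un_least image_subsetI)
    (simp_all add: split_beta mem_Times_iff e_closed smult_one_closed snd_smult_one_closed
      del: W2_simps)

lemma submodule_tot_kernel: "submodule (tot_kernel p k A) A0 F"
  unfolding tot_kernel_def by (rule F.submodule_submodule_gen[OF tot_relations_closed])

text \<open>Each relation is a difference of two sides, so a linear map kills it exactly when it
  takes equal values on both. The equivalence is used in both directions: to extract a derivation
  from a homomorphism, and to build a homomorphism from a derivation.\<close>

lemma hom_vanishes_on_tot_relations_iff: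
  assumes H: "H \<in> module_homs A0 F S0"
  shows "(\<forall>f\<in>tot_relations p k A. H f = \<zero>\<^bsub>A0\<^esub>) \<longleftrightarrow>
    tot_derivation p k A (H (e (p_elt p A))) (\<lambda>x. H (e x))"
proof -
  note H_simps = module_homs_minus[OF F.abelian_group_axioms S0.abelian_group_axioms H]
    module_homs_add[OF H] module_homs_smult[OF H] e_closed smult_one_closed snd_smult_one_closed
  have Hcl: "H f \<in> carrier A0" if "f \<in> carrier F" for f
    using module_homs_closed[OF H that] by simp
  have S0_minus: "x \<ominus>\<^bsub>S0\<^esub> y = \<zero>\<^bsub>A0\<^esub> \<longleftrightarrow> x = y" if "x \<in> carrier A0" "y \<in> carrier A0" for x y
    using that S0.minus_eq_zero_iff[of x y] by simp
  have "H (e (a \<oplus>\<^bsub>A\<^esub> b) \<ominus>\<^bsub>F\<^esub> (e a \<oplus>\<^bsub>F\<^esub> e b \<oplus>\<^bsub>F\<^esub> \<pi> (Cp p A a b) \<odot>\<^bsub>F\<^esub> e (p_elt p A))) = \<zero>\<^bsub>A0\<^esub> \<longleftrightarrow>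
      H (e (a \<oplus>\<^bsub>A\<^esub> b)) = H (e a) \<oplus>\<^bsub>A0\<^esub> H (e b) \<oplus>\<^bsub>A0\<^esub> \<pi> (Cp p A a b) \<otimes>\<^bsub>A0\<^esub> H (e (p_elt p A))"
    and "H (e (a \<otimes>\<^bsub>A\<^esub> b) \<ominus>\<^bsub>F\<^esub> (\<pi> (b [^]\<^bsub>A\<^esub> p) \<odot>\<^bsub>F\<^esub> e a \<oplus>\<^bsub>F\<^esub> \<pi> (a [^]\<^bsub>A\<^esub> p) \<odot>\<^bsub>F\<^esub> e b)) = \<zero>\<^bsub>A0\<^esub> \<longleftrightarrow>
      H (e (a \<otimes>\<^bsub>A\<^esub> b)) = \<pi> (b [^]\<^bsub>A\<^esub> p) \<otimes>\<^bsub>A0\<^esub> H (e a) \<oplus>\<^bsub>A0\<^esub> \<pi> (a [^]\<^bsub>A\<^esub> p) \<otimes>\<^bsub>A0\<^esub> H (e b)"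
    if "a \<in> carrier A" "b \<in> carrier A" for a b
    using that by (simp_all add: H_simps Hcl S0_minus)
  moreover have "H (e (r \<odot>\<^bsub>A\<^esub> \<one>\<^bsub>A\<^esub>) \<ominus>\<^bsub>F\<^esub> (snd r \<odot>\<^bsub>A0\<^esub> \<one>\<^bsub>A0\<^esub>) \<odot>\<^bsub>F\<^esub> e (p_elt p A)) = \<zero>\<^bsub>A0\<^esub> \<longleftrightarrow>
      H (e (r \<odot>\<^bsub>A\<^esub> \<one>\<^bsub>A\<^esub>)) = (snd r \<odot>\<^bsub>A0\<^esub> \<one>\<^bsub>A0\<^esub>) \<otimes>\<^bsub>A0\<^esub> H (e (p_elt p A))"
    if "r \<in> carrier W" for r
    using that by (simp add: H_simps Hcl S0_minus del: W2_simps)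
  ultimately show ?thesis
    unfolding tot_relations_eq tot_derivation_def Let_def ball_Un ball_simps
    by (simp add: conj_assoc del: W2_simps cong: ball_cong)
qed

lemma tot_derivation_cong:
  assumes "\<And>x. x \<in> carrier A \<Longrightarrow> \<delta> x = \<delta>' x"
  shows "tot_derivation p k A c \<delta> \<longleftrightarrow> tot_derivation p k A c \<delta>'"
  unfolding tot_derivation_def Let_def
  using assms by (simp add: smult_one_closed del: W2_simps cong: ball_cong)

lemma Omega_tot_hom_derivation:
  assumes h: "h \<in> module_homs A0 (Omega_tot p k A) S0"
  shows "tot_derivation p k A (h (d_tot p k A (p_elt p A))) (\<lambda>x. h (d_tot p k A x))"
    and "x \<in> carrier A \<Longrightarrow> h (d_tot p k A x) \<in> carrier A0"
proof -
  let ?K = "tot_kernel p k A"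
  let ?H = "\<lambda>f\<in>carrier F. h (?K +>\<^bsub>F\<^esub> f)"
  have h': "h \<in> module_homs A0 (quot_module F ?K) S0"
    using h by (simp add: Omega_tot_def)
  have H: "?H \<in> module_homs A0 F S0"
    by (rule F.module_homs_quot_comp(1)[OF submodule_tot_kernel module_S0 h'])
  have He: "?H (e x) = h (d_tot p k A x)" if "x \<in> carrier A" for x
    using e_closed[OF that] by (simp add: d_tot_def)
  have "?H f = \<zero>\<^bsub>A0\<^esub>" if "f \<in> tot_relations p k A" for f
  proof -
    have "f \<in> ?K"
      unfolding tot_kernel_def by (rule subsetD[OF submodule_gen_superset that])
    then have "h (?K +>\<^bsub>F\<^esub> f) = \<zero>\<^bsub>A0\<^esub>"
      using F.module_homs_quot_comp(2)[OF submodule_tot_kernel module_S0 h'] by simp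
    then show ?thesis
      using subsetD[OF tot_relations_closed that] by simp
  qed
  then have "tot_derivation p k A (?H (e (p_elt p A))) (\<lambda>x. ?H (e x))"
    using hom_vanishes_on_tot_relations_iff[OF H] by blast
  then show "tot_derivation p k A (h (d_tot p k A (p_elt p A))) (\<lambda>x. h (d_tot p k A x))"
    unfolding He[OF p_elt_closed] by (rule iffD1[OF tot_derivation_cong, rotated]) (rule He)
  show "x \<in> carrier A \<Longrightarrow> h (d_tot p k A x) \<in> carrier A0"
    using module_homs_closed[OF H e_closed] He by simp
qed

text \<open>The linear extension of the map to the free module kills the relations and descends. The
  constant is the value at p, as the relations themselves contain the differential of p; it becomes
  1 only for left-inverses.\<close>

lemma ex_Omega_tot_hom:
  assumes \<delta>: "tot_derivation p k A (\<delta> (p_elt p A)) \<delta>" and cl: "\<And>x. x \<in> carrier A \<Longrightarrow> \<delta> x \<in> carrier A0"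
  shows "\<exists>h\<in>module_homs A0 (Omega_tot p k A) S0. \<forall>x\<in>carrier A. h (d_tot p k A x) = \<delta> x"
proof -
  let ?L = "restrict (linear_ext A0 S0 \<delta>) (carrier F)"
  have L: "?L \<in> module_homs A0 F S0"
    using cl by (intro S0.linear_ext_hom) simp
  have Le: "?L (e x) = \<delta> x" if "x \<in> carrier A" for x
    using that cl e_closed[OF that] S0.linear_ext_basis_elt[of x "carrier A" \<delta>] by simp
  have "tot_derivation p k A (?L (e (p_elt p A))) (\<lambda>x. ?L (e x))"
    using \<delta> unfolding Le[OF p_elt_closed] by (rule iffD2[OF tot_derivation_cong, rotated]) (rule Le)
  then have zero: "\<forall>f\<in>tot_relations p k A. ?L f = \<zero>\<^bsub>S0\<^esub>"
    using hom_vanishes_on_tot_relations_iff[OF L] by simp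
  have "\<exists>h\<in>module_homs A0 (Omega_tot p k A) S0. \<forall>f\<in>carrier F. h (tot_kernel p k A +>\<^bsub>F\<^esub> f) = ?L f"
    unfolding Omega_tot_def tot_kernel_def
    by (rule F.ex_module_homs_quot[OF module_S0 L tot_relations_closed bspec[OF zero]])
  then obtain h where h: "h \<in> module_homs A0 (Omega_tot p k A) S0"
    "\<forall>f\<in>carrier F. h (tot_kernel p k A +>\<^bsub>F\<^esub> f) = ?L f"
    by (elim bexE)
  have "h (d_tot p k A x) = \<delta> x" if x: "x \<in> carrier A" for x
    unfolding d_tot_def using bspec[OF h(2) e_closed[OF x]] Le[OF x] by (rule trans)
  then show ?thesis
    using h(1) by blast
qed

text \<open>The differentials are the images of the basis of the free module and so
  generate.\<close>

lemma Omega_tot_hom_eqI: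
  assumes h: "h \<in> module_homs A0 (Omega_tot p k A) S0" and h': "h' \<in> module_homs A0 (Omega_tot p k A) S0"
    and eq: "\<And>x. x \<in> carrier A \<Longrightarrow> h (d_tot p k A x) = h' (d_tot p k A x)"
  shows "h = h'"
proof -
  let ?K = "tot_kernel p k A"
  note comp = F.module_homs_quot_comp(1)[OF submodule_tot_kernel module_S0, folded Omega_tot_def]
  have "h c = h' c" if c: "c \<in> carrier (Omega_tot p k A)" for c
  proof -
    obtain f where f: "f \<in> carrier F" "c = ?K +>\<^bsub>F\<^esub> f"
      using c by (auto simp: Omega_tot_def F.quot_module_carrier)
    then show ?thesis
      using S0.free_module_hom_eqI[OF comp[OF h] comp[OF h'] _ f(1)] eq e_closed
      by (simp add: d_tot_def)
  qed
  moreover have "h \<in> extensional (carrier (Omega_tot p k A))" "h' \<in> extensional (carrier (Omega_tot p k A))"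
    using h h' by (auto simp: module_homs_def PiE_def)
  ultimately show ?thesis
    by (intro extensionalityI)
qed

text \<open>In A the element p is the scalar (0, 1), whose second coordinate is 1. The rule for
  scalars thus forces the normalization that a left-inverse needs.\<close>

lemma tot_derivation_p_elt:
  assumes "tot_derivation p k A \<one>\<^bsub>A0\<^esub> \<delta>"
  shows "\<delta> (p_elt p A) = \<one>\<^bsub>A0\<^esub>"
proof -
  have "(\<zero>, \<one>) \<in> carrier W"
    by simp
  then show ?thesis
    using assms unfolding tot_derivation_def Let_def p_elt_eq by fastforce
qed

lemma frobenius_lift_iff_tot_derivation:
  assumes \<delta>: "\<And>x. x \<in> carrier A \<Longrightarrow> \<delta> x \<in> carrier A0"
  defines "\<phi> \<equiv> \<lambda>x\<in>carrier A. x [^]\<^bsub>A\<^esub> p \<oplus>\<^bsub>A\<^esub> times_p p A (\<delta> x)"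
  shows "\<phi> \<in> frobenius_lifts p k A \<longleftrightarrow> tot_derivation p k A \<one>\<^bsub>A0\<^esub> \<delta>"
proof -
  let ?T = "times_p p A"
  have \<phi>: "\<phi> x = x [^]\<^bsub>A\<^esub> p \<oplus>\<^bsub>A\<^esub> ?T (\<delta> x)" if "x \<in> carrier A" for x
    using that by (simp add: \<phi>_def)
  have \<phi>_cl: "\<phi> x \<in> carrier A" if "x \<in> carrier A" for x
    using that \<delta> by (simp add: \<phi>)
  have add: "\<phi> (a \<oplus>\<^bsub>A\<^esub> b) = \<phi> a \<oplus>\<^bsub>A\<^esub> \<phi> b \<longleftrightarrow>
      \<delta> (a \<oplus>\<^bsub>A\<^esub> b) = \<delta> a \<oplus>\<^bsub>A0\<^esub> \<delta> b \<oplus>\<^bsub>A0\<^esub> \<pi> (Cp p A a b) \<otimes>\<^bsub>A0\<^esub> \<one>\<^bsub>A0\<^esub>"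
    if a: "a \<in> carrier A" and b: "b \<in> carrier A" for a b
  proof -
    have C: "\<pi> (Cp p A a b) \<in> carrier A0"
      using a b by simp
    \<comment> \<open>Additivity of the p-th power fails by p C_p(a, b), which is the term that the
      derivation must supply.\<close>
    have "?T (\<pi> (Cp p A a b)) = a [^]\<^bsub>A\<^esub> p \<oplus>\<^bsub>A\<^esub> b [^]\<^bsub>A\<^esub> p \<ominus>\<^bsub>A\<^esub> (a \<oplus>\<^bsub>A\<^esub> b) [^]\<^bsub>A\<^esub> p"
      using a b by (simp add: times_p_red A.p_times_Cp[OF prime_p])
    then have "a [^]\<^bsub>A\<^esub> p \<oplus>\<^bsub>A\<^esub> b [^]\<^bsub>A\<^esub> p = (a \<oplus>\<^bsub>A\<^esub> b) [^]\<^bsub>A\<^esub> p \<oplus>\<^bsub>A\<^esub> ?T (\<pi> (Cp p A a b))"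
      using a b by (simp add: A.minus_eq A.a_ac A.r_neg)
    moreover have "\<phi> a \<oplus>\<^bsub>A\<^esub> \<phi> b = (a [^]\<^bsub>A\<^esub> p \<oplus>\<^bsub>A\<^esub> b [^]\<^bsub>A\<^esub> p) \<oplus>\<^bsub>A\<^esub> (?T (\<delta> a) \<oplus>\<^bsub>A\<^esub> ?T (\<delta> b))"
      using a b \<delta> by (simp add: \<phi> A.a_ac)
    ultimately have "\<phi> a \<oplus>\<^bsub>A\<^esub> \<phi> b =
        (a \<oplus>\<^bsub>A\<^esub> b) [^]\<^bsub>A\<^esub> p \<oplus>\<^bsub>A\<^esub> (?T (\<pi> (Cp p A a b)) \<oplus>\<^bsub>A\<^esub> (?T (\<delta> a) \<oplus>\<^bsub>A\<^esub> ?T (\<delta> b)))"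
      using a b \<delta> C by (simp add: A.a_assoc)
    also have "?T (\<pi> (Cp p A a b)) \<oplus>\<^bsub>A\<^esub> (?T (\<delta> a) \<oplus>\<^bsub>A\<^esub> ?T (\<delta> b)) = ?T (\<delta> a \<oplus>\<^bsub>A0\<^esub> \<delta> b \<oplus>\<^bsub>A0\<^esub> \<pi> (Cp p A a b))"
      using a b \<delta> C by (simp add: times_p_add A.a_ac)
    finally show ?thesis
      using a b \<delta> C by (simp add: \<phi>[of "a \<oplus>\<^bsub>A\<^esub> b"] times_p_inj)
  qed
  have mult: "\<phi> (a \<otimes>\<^bsub>A\<^esub> b) = \<phi> a \<otimes>\<^bsub>A\<^esub> \<phi> b \<longleftrightarrow>
      \<delta> (a \<otimes>\<^bsub>A\<^esub> b) = \<pi> (b [^]\<^bsub>A\<^esub> p) \<otimes>\<^bsub>A0\<^esub> \<delta> a \<oplus>\<^bsub>A0\<^esub> \<pi> (a [^]\<^bsub>A\<^esub> p) \<otimes>\<^bsub>A0\<^esub> \<delta> b"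
    if a: "a \<in> carrier A" and b: "b \<in> carrier A" for a b
  proof -
    have ab: "a [^]\<^bsub>A\<^esub> p \<in> carrier A" "b [^]\<^bsub>A\<^esub> p \<in> carrier A"
      using a b by simp_all
    \<comment> \<open>The last of the four products is a product of two multiples of p and vanishes
      because p^2 = 0.\<close>
    have "\<phi> a \<otimes>\<^bsub>A\<^esub> \<phi> b = a [^]\<^bsub>A\<^esub> p \<otimes>\<^bsub>A\<^esub> b [^]\<^bsub>A\<^esub> p \<oplus>\<^bsub>A\<^esub>
        (b [^]\<^bsub>A\<^esub> p \<otimes>\<^bsub>A\<^esub> ?T (\<delta> a) \<oplus>\<^bsub>A\<^esub> a [^]\<^bsub>A\<^esub> p \<otimes>\<^bsub>A\<^esub> ?T (\<delta> b)) \<oplus>\<^bsub>A\<^esub> ?T (\<delta> a) \<otimes>\<^bsub>A\<^esub> ?T (\<delta> b)"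
      using a b \<delta> ab by (simp only: \<phi> A.l_distr A.r_distr times_p_closed A.a_closed A.m_closed A.a_ac A.m_ac)
    also have "\<dots> = (a \<otimes>\<^bsub>A\<^esub> b) [^]\<^bsub>A\<^esub> p \<oplus>\<^bsub>A\<^esub>
        ?T (\<pi> (b [^]\<^bsub>A\<^esub> p) \<otimes>\<^bsub>A0\<^esub> \<delta> a \<oplus>\<^bsub>A0\<^esub> \<pi> (a [^]\<^bsub>A\<^esub> p) \<otimes>\<^bsub>A0\<^esub> \<delta> b)"
      using a b \<delta> ab by (simp add: times_p_mult_times_p times_p_add times_p_mult A.nat_pow_distrib del: red.hom_pow)
    finally show ?thesis
      using a b \<delta> ab by (simp add: \<phi>[of "a \<otimes>\<^bsub>A\<^esub> b"] times_p_inj)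
  qed
  have scalar: "\<phi> (r \<odot>\<^bsub>A\<^esub> \<one>\<^bsub>A\<^esub>) = W2_frob p k r \<odot>\<^bsub>A\<^esub> \<one>\<^bsub>A\<^esub> \<longleftrightarrow>
      \<delta> (r \<odot>\<^bsub>A\<^esub> \<one>\<^bsub>A\<^esub>) = (snd r \<odot>\<^bsub>A0\<^esub> \<one>\<^bsub>A0\<^esub>) \<otimes>\<^bsub>A0\<^esub> \<one>\<^bsub>A0\<^esub>"
    if r: "r \<in> carrier W" for r
    using smult_one_closed[OF r] snd_smult_one_closed[OF r] \<delta>
    by (simp add: \<phi> W2_frob_smult_one[OF r] times_p_inj)
  \<comment> \<open>This holds for every choice of values of the derivation, because multiples of p
    reduce to zero.\<close>
  have red: "\<pi> (\<phi> x) = \<pi> x [^]\<^bsub>A0\<^esub> p" if "x \<in> carrier A" for x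
    using that \<delta> by (simp add: \<phi>)
  \<comment> \<open>A ring homomorphism must preserve 1, which is not among the derivation rules. It
    follows from the condition on scalars at r = 1.\<close>
  have one: "\<phi> \<one>\<^bsub>A\<^esub> = \<one>\<^bsub>A\<^esub>"
    if "\<forall>r\<in>carrier W. \<phi> (r \<odot>\<^bsub>A\<^esub> \<one>\<^bsub>A\<^esub>) = W2_frob p k r \<odot>\<^bsub>A\<^esub> \<one>\<^bsub>A\<^esub>"
  proof -
    have "W2_frob p k \<one>\<^bsub>W\<^esub> = \<one>\<^bsub>W\<^esub>"
      using p_gt_0 by (simp add: W2_frob_def nat_pow_zero)
    then show ?thesis
      using bspec[OF that W.one_closed] by (simp only: AW.smult_one A.one_closed)
  qed
  have "\<phi> \<in> extensional (carrier A)"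
    by (simp add: \<phi>_def)
  then show ?thesis
    unfolding frobenius_lifts_def ring_hom_def tot_derivation_def Let_def
    using add mult scalar red one \<phi>_cl
    by (auto simp del: W2_simps)
qed

lemma bij_betw_lift_of_left_inverse:
  "bij_betw (lift_of_left_inverse p k A) (alpha_left_inverses p k A) (frobenius_lifts p k A)"
proof (rule bij_betwI')
  fix h h' assume "h \<in> alpha_left_inverses p k A" "h' \<in> alpha_left_inverses p k A"
  then have h: "h \<in> module_homs A0 (Omega_tot p k A) S0" and h': "h' \<in> module_homs A0 (Omega_tot p k A) S0"
    by (simp_all add: alpha_left_inverses_def)
  show "lift_of_left_inverse p k A h = lift_of_left_inverse p k A h' \<longleftrightarrow> h = h'"
  proof
    assume eq: "lift_of_left_inverse p k A h = lift_of_left_inverse p k A h'"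
    show "h = h'"
    proof (rule Omega_tot_hom_eqI[OF h h'])
      fix x assume x: "x \<in> carrier A"
      have "lift_of_left_inverse p k A h x = lift_of_left_inverse p k A h' x"
        using eq by simp
      then show "h (d_tot p k A x) = h' (d_tot p k A x)"
        using x Omega_tot_hom_derivation(2)[OF h x] Omega_tot_hom_derivation(2)[OF h' x]
        by (simp add: lift_of_left_inverse_def times_p_inj)
    qed
  qed simp
next
  fix h assume "h \<in> alpha_left_inverses p k A"
  then have h: "h \<in> module_homs A0 (Omega_tot p k A) S0" and hp: "h (d_tot p k A (p_elt p A)) = \<one>\<^bsub>A0\<^esub>"
    by (simp_all add: alpha_left_inverses_def)
  show "lift_of_left_inverse p k A h \<in> frobenius_lifts p k A"
    unfolding lift_of_left_inverse_def
    using Omega_tot_hom_derivation(1)[OF h] unfolding hp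
    by (rule iffD2[OF frobenius_lift_iff_tot_derivation, rotated]) (rule Omega_tot_hom_derivation(2)[OF h])
next
  fix \<phi> assume \<phi>: "\<phi> \<in> frobenius_lifts p k A"
  have \<phi>_cl: "\<phi> x \<in> carrier A" and \<phi>_red: "\<pi> (\<phi> x) = \<pi> x [^]\<^bsub>A0\<^esub> p" if "x \<in> carrier A" for x
    using \<phi> that by (auto simp: frobenius_lifts_def ring_hom_def)
  have "\<exists>y. y \<in> carrier A0 \<and> \<phi> x = x [^]\<^bsub>A\<^esub> p \<oplus>\<^bsub>A\<^esub> times_p p A y" if x: "x \<in> carrier A" for x
  proof -
    \<comment> \<open>The map and the p-th power agree modulo p, and the class of \<open>z\<close>
      becomes the value of the derivation at \<open>x\<close>.\<close>
    obtain z where "z \<in> carrier A" "\<phi> x = x [^]\<^bsub>A\<^esub> p \<oplus>\<^bsub>A\<^esub> [p] \<cdot>\<^bsub>A\<^esub> z"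
      using red_eq_iff[OF \<phi>_cl[OF x] A.nat_pow_closed[OF x, of p]] \<phi>_red[OF x] x by auto
    then show ?thesis
      by (intro exI[of _ "\<pi> z"]) (simp add: times_p_red)
  qed
  then obtain \<delta> where \<delta>: "\<And>x. x \<in> carrier A \<Longrightarrow> \<delta> x \<in> carrier A0"
    "\<And>x. x \<in> carrier A \<Longrightarrow> \<phi> x = x [^]\<^bsub>A\<^esub> p \<oplus>\<^bsub>A\<^esub> times_p p A (\<delta> x)"
    by metis
  have "\<phi> \<in> extensional (carrier A)"
    using \<phi> by (simp add: frobenius_lifts_def)
  then have \<phi>_eq: "\<phi> = (\<lambda>x\<in>carrier A. x [^]\<^bsub>A\<^esub> p \<oplus>\<^bsub>A\<^esub> times_p p A (\<delta> x))"
    by (rule extensionalityI) (simp_all add: \<delta>(2))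
  then have der: "tot_derivation p k A \<one>\<^bsub>A0\<^esub> \<delta>"
    using \<phi> frobenius_lift_iff_tot_derivation[OF \<delta>(1)] by simp
  note \<delta>p = tot_derivation_p_elt[OF der]
  \<comment> \<open>The constant 1 is traded for the value at p, the form in which a derivation
    extends to the total differentials.\<close>
  have "tot_derivation p k A (\<delta> (p_elt p A)) \<delta>"
    using der by (simp only: \<delta>p)
  then obtain h where h: "h \<in> module_homs A0 (Omega_tot p k A) S0"
    "\<And>x. x \<in> carrier A \<Longrightarrow> h (d_tot p k A x) = \<delta> x"
    using ex_Omega_tot_hom[of \<delta>, OF _ \<delta>(1)] by blast
  have "h \<in> alpha_left_inverses p k A"
    using h \<delta>p by (simp add: alpha_left_inverses_def)
  moreover have "\<phi> = lift_of_left_inverse p k A h"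
    unfolding \<phi>_eq lift_of_left_inverse_def by (rule restrict_ext) (simp add: h(2))
  ultimately show "\<exists>h\<in>alpha_left_inverses p k A. \<phi> = lift_of_left_inverse p k A h"
    by blast
qed

end

theorem mainTheorem3:
  fixes k :: "('k, 'e) ring_scheme"
    and p :: nat
    and A :: "('k \<times> 'k, 'a) module"
  assumes "field k" and "ring_char k = p" and "p > 2"
    and "finitely_generated_algebra (W2 p k) A"
    and "flat_module (W2 p k) A"
    and "algebra k (reduction p k A)"
  shows "bij_betw (lift_of_left_inverse p k A) (alpha_left_inverses p k A) (frobenius_lifts p k A)"
proof -
  have A: "algebra (W2 p k) A"
    using assms(4) by (simp add: finitely_generated_algebra_def)
  have "domain k"
    using assms(1) by (rule field.axioms(1))
  then have "prime p" "[p] \<cdot>\<^bsub>k\<^esub> \<one>\<^bsub>k\<^esub> = \<zero>\<^bsub>k\<^esub>"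
    using prime_ring_char assms(2,3) by force+
  then have "witt_algebra k p A"
    using A assms algebra.R_cring[OF A]
    by (intro witt_algebra.intro witt_field.intro witt_field_axioms.intro witt_algebra_axioms.intro)
  then interpret witt_algebra k p A .
  show ?thesis
    by (rule bij_betw_lift_of_left_inverse)
qed

end
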